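(* For all positive integers $a,b,n$, the $(a,b)$-Catalan matroid $C_n^{a,b}$ is Ehrhart positive: all coefficients of its Ehrhart polynomial $i(C_n^{a,b},t)$ are positive.
   Context: For $S\subseteq[N]$, the Schubert matroid $\mathrm{SM}_N(S)$ is the matroid on $[N]$ whose bases are the $T\subseteq[N]$ with $|T|=|S|$ such that for every $i$ the $i$-th smallest element of $T$ is at most the $i$-th smallest element of $S$. The $(a,b)$-Catalan matroid $C_n^{a,b}$ is $\mathrm{SM}_{n(a+b)}(S)$ where $S$ has indicator vector $(0^a,1^b,\dots,0^a,1^b)$ ($n$ blocks of $a$ zeros followed by $b$ ones). For a matroid $M$ on $[N]$, $\mathcal P(M)=\mathrm{conv}\{e_B: B\text{ a basis of }M\}\subset\mathbb R^N$, and $i(M,t)$ is its Ehrhart polynomial: the polynomial with $i(M,t)=|t\mathcal P(M)\cap\mathbb Z^N|$ for all positive integers $t$. "All coefficients" refers to the coefficients of $t^0,t^1,\dots,t^{d}$, where $d$ is the degree of the polynomial. *)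

theory Defs
  imports
    "HOL-Analysis.Analysis"
    "HOL-Analysis.Finite_Function_Topology"
    "HOL-Computational_Algebra.Polynomial"
begin

section \<open>Matroids given by their bases\<close>

definition is_matroid :: "'a set \<Rightarrow> 'a set set \<Rightarrow> bool" where
  "is_matroid E \<B> \<longleftrightarrow>
     finite E \<and> \<B> \<noteq> {} \<and> (\<forall>B\<in>\<B>. B \<subseteq> E) \<and>
     (\<forall>A\<in>\<B>. \<forall>B\<in>\<B>. \<forall>x\<in>A - B. \<exists>y\<in>B - A. insert y (A - {x}) \<in> \<B>)"

section \<open>Schubert matroids and Catalan matroids\<close>

text \<open>The list \<open>sorted_list_of_set T\<close> is increasing and indexed from 0, so its entry with
  index \<open>i\<close> is the \<open>(i + 1)\<close>-th smallest element of \<open>T\<close>.\<close>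

definition schubert_bases :: "nat \<Rightarrow> nat set \<Rightarrow> nat set set" where
  "schubert_bases N S =
     {T. T \<subseteq> {1..N} \<and> card T = card S \<and>
         (\<forall>i<card S. sorted_list_of_set T ! i \<le> sorted_list_of_set S ! i)}"

definition catalan_word :: "nat \<Rightarrow> nat \<Rightarrow> nat \<Rightarrow> nat list" where
  "catalan_word a b n = concat (replicate n (replicate a 0 @ replicate b 1))"

definition catalan_set :: "nat \<Rightarrow> nat \<Rightarrow> nat \<Rightarrow> nat set" where
  "catalan_set a b n = {i \<in> {1..n * (a + b)}. catalan_word a b n ! (i - 1) = 1}"

definition catalan_bases :: "nat \<Rightarrow> nat \<Rightarrow> nat \<Rightarrow> nat set set" where
  "catalan_bases a b n = schubert_bases (n * (a + b)) (catalan_set a b n)"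

section \<open>Matroid polytopes and Ehrhart polynomials\<close>

text \<open>Since \<open>N\<close> varies, \<open>\<real>\<^sup>N\<close> is realised as the subspace of the real vector space
  \<open>nat \<Rightarrow>\<^sub>0 real\<close> consisting of the vectors whose coordinates outside \<open>{1..N}\<close> vanish.\<close>

definition integer_points :: "nat \<Rightarrow> (nat \<Rightarrow>\<^sub>0 real) set" where
  "integer_points N =
     {x. Poly_Mapping.keys x \<subseteq> {1..N} \<and> (\<forall>i\<in>{1..N}. Poly_Mapping.lookup x i \<in> \<int>)}"

definition indicator_vector :: "nat set \<Rightarrow> (nat \<Rightarrow>\<^sub>0 real)" where
  "indicator_vector B = (\<Sum>i\<in>B. Poly_Mapping.single i 1)"

definition matroid_polytope :: "nat set set \<Rightarrow> (nat \<Rightarrow>\<^sub>0 real) set" where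
  "matroid_polytope \<B> = convex hull (indicator_vector ` \<B>)"

definition is_ehrhart_polynomial :: "nat \<Rightarrow> nat set set \<Rightarrow> real poly \<Rightarrow> bool" where
  "is_ehrhart_polynomial N \<B> p \<longleftrightarrow>
     (\<forall>t::nat. t > 0 \<longrightarrow>
        poly p (real t) =
          real (card ((\<lambda>x. real t *\<^sub>R x) ` matroid_polytope \<B> \<inter> integer_points N)))"

definition ehrhart_polynomial :: "nat \<Rightarrow> nat set set \<Rightarrow> real poly" where
  "ehrhart_polynomial N \<B> = (THE p. is_ehrhart_polynomial N \<B> p)"

definition ehrhart_positive :: "nat \<Rightarrow> nat set set \<Rightarrow> bool" where
  "ehrhart_positive N \<B> \<longleftrightarrow>
     (\<forall>k \<le> degree (ehrhart_polynomial N \<B>). coeff (ehrhart_polynomial N \<B>) k > 0)"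

section \<open>Well-definedness\<close>

lemma is_ehrhart_polynomial_unique:
  assumes "is_ehrhart_polynomial N \<B> p" "is_ehrhart_polynomial N \<B> q"
  shows "p = q"
proof (rule ccontr)
  assume "p \<noteq> q"
  then have "finite {x. poly (p - q) x = 0}"
    by (intro poly_roots_finite) simp
  moreover have "real ` {0<..} \<subseteq> {x. poly (p - q) x = 0}"
    using assms by (auto simp: is_ehrhart_polynomial_def)
  ultimately have "finite (real ` {0<..})"
    using finite_subset by blast
  then have "finite {0::nat<..}"
    by (rule finite_imageD) simp
  then show False
    using infinite_Ioi by blast
qed

lemma ehrhart_polynomial_eqI:
  "is_ehrhart_polynomial N \<B> p \<Longrightarrow> ehrhart_polynomial N \<B> = p"
  unfolding ehrhart_polynomial_def by (blast intro: is_ehrhart_polynomial_unique)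

lemma lookup_indicator_vector:
  assumes "finite B"
  shows "Poly_Mapping.lookup (indicator_vector B) i = (if i \<in> B then 1 else 0)"
  using assms by (simp add: indicator_vector_def lookup_sum lookup_single when_def)

lemma sorted_list_of_set_nth_le_iff:
  fixes T :: "nat set"
  assumes "finite T" "i < card T"
  shows "sorted_list_of_set T ! i \<le> k \<longleftrightarrow> i < card (T \<inter> {..k})"
proof -
  let ?xs = "sorted_list_of_set T"
  let ?D = "{j. j < card T \<and> ?xs ! j \<le> k}"
  have len: "length ?xs = card T" by simp
  have "bij_betw ((!) ?xs) {..<card T} T"
    using bij_betw_nth[of ?xs "{..<card T}" T] assms by simp
  then have inj: "inj_on ((!) ?xs) {..<card T}" and im: "(!) ?xs ` {..<card T} = T"
    by (auto simp: bij_betw_def)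
  have "T \<inter> {..k} = (!) ?xs ` ?D"
    using im by (auto simp: image_iff)
  moreover have "inj_on ((!) ?xs) ?D"
    by (rule inj_on_subset[OF inj]) auto
  ultimately have c: "card (T \<inter> {..k}) = card ?D"
    by (simp add: card_image)
  have fin: "finite ?D" by simp
  have mono: "?xs ! j \<le> ?xs ! l" if "j \<le> l" "l < card T" for j l
    using that by (intro sorted_nth_mono) auto
  show ?thesis
  proof
    assume "?xs ! i \<le> k"
    then have "j < card T \<and> ?xs ! j \<le> k" if "j \<le> i" for j
      using that assms(2) mono[of j i] by linarith
    then have "{..i} \<subseteq> ?D" by blast
    then have "card {..i} \<le> card ?D"
      by (rule card_mono[OF fin])
    then show "i < card (T \<inter> {..k})" using c by simp
  next
    assume *: "i < card (T \<inter> {..k})"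
    show "?xs ! i \<le> k"
    proof (rule ccontr)
      assume "\<not> ?xs ! i \<le> k"
      then have "j < i" if "j < card T" "?xs ! j \<le> k" for j
        using that mono[of i j] by linarith
      then have "?D \<subseteq> {..<i}" by blast
      then have "card ?D \<le> card {..<i}"
        by (intro card_mono) auto
      then show False using * c by simp
    qed
  qed
qed

lemma schubert_bases_iff_card:
  assumes "finite S"
  shows "T \<in> schubert_bases N S \<longleftrightarrow>
    T \<subseteq> {1..N} \<and> card T = card S \<and> (\<forall>k. card (S \<inter> {..k}) \<le> card (T \<inter> {..k}))"
proof -
  have "(\<forall>i<card S. sorted_list_of_set T ! i \<le> sorted_list_of_set S ! i) \<longleftrightarrow>
        (\<forall>k. card (S \<inter> {..k}) \<le> card (T \<inter> {..k}))" (is "?L \<longleftrightarrow> ?R")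
    if T: "T \<subseteq> {1..N}" and c: "card T = card S"
  proof -
    have fT: "finite T" using T finite_subset by blast
    note iffS = sorted_list_of_set_nth_le_iff[OF assms]
    note iffT = sorted_list_of_set_nth_le_iff[OF fT, unfolded c]
    show ?thesis
    proof
      assume L: ?L
      show ?R
      proof (rule allI, rule ccontr)
        fix k
        let ?i = "card (T \<inter> {..k})"
        assume "\<not> card (S \<inter> {..k}) \<le> ?i"
        then have i: "?i < card (S \<inter> {..k})" by simp
        also have "\<dots> \<le> card S" using assms by (intro card_mono) auto
        finally have iS: "?i < card S" .
        then have "sorted_list_of_set S ! ?i \<le> k" using iffS i by blast
        then have "sorted_list_of_set T ! ?i \<le> k" using L iS order_trans by blast
        then show False using iffT[OF iS] by blast
      qed
    next
      assume R: ?R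
      show ?L
      proof (intro allI impI)
        fix i assume i: "i < card S"
        let ?k = "sorted_list_of_set S ! i"
        have "i < card (S \<inter> {..?k})" using iffS[OF i] by blast
        then have "i < card (T \<inter> {..?k})" using R order_less_le_trans by blast
        then show "sorted_list_of_set T ! i \<le> ?k" using iffT[OF i] by blast
      qed
    qed
  qed
  then show ?thesis
    unfolding schubert_bases_def by blast
qed

lemma is_matroid_schubert:
  assumes "S \<subseteq> {1..N}"
  shows "is_matroid {1..N} (schubert_bases N S)"
  unfolding is_matroid_def
proof (intro conjI ballI)
  have fS: "finite S" using assms finite_subset by blast
  note iff = schubert_bases_iff_card[OF fS]
  have "S \<in> schubert_bases N S" using assms by (simp add: schubert_bases_def)
  then show "schubert_bases N S \<noteq> {}" by blast
  show "B \<subseteq> {1..N}" if "B \<in> schubert_bases N S" for B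
    using that by (simp add: schubert_bases_def)
  fix A B x
  assume A: "A \<in> schubert_bases N S" and B: "B \<in> schubert_bases N S" and x: "x \<in> A - B"
  have fA: "finite A" and fB: "finite B"
    using A B finite_subset by (auto simp: schubert_bases_def)
  have cAB: "card A = card B" using A B by (simp add: schubert_bases_def)
  have ne: "B - A \<noteq> {}"
    using x cAB card_subset_eq[OF fA, of B] by auto
  define y where "y = Min (B - A)"
  have y: "y \<in> B - A" unfolding y_def using fB ne by (intro Min_in) auto
  have ymin: "y \<le> z" if "z \<in> B - A" for z
    unfolding y_def using fB that by (intro Min_le) auto
  let ?C = "insert y (A - {x})"
  have "?C \<in> schubert_bases N S"
    unfolding iff
  proof (intro conjI allI)
    show "?C \<subseteq> {1..N}" using A B y by (auto simp: schubert_bases_def)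
    have "card ?C = Suc (card (A - {x}))" using y fA by (intro card_insert_disjoint) auto
    also have "\<dots> = card A" using x fA by (intro card_Suc_Diff1) auto
    finally have "card ?C = card A" .
    then show "card ?C = card S" using A by (simp add: schubert_bases_def)
    fix k
    have SA: "card (S \<inter> {..k}) \<le> card (A \<inter> {..k})"
      and SB: "card (S \<inter> {..k}) \<le> card (B \<inter> {..k})"
      using A B unfolding iff by auto
    show "card (S \<inter> {..k}) \<le> card (?C \<inter> {..k})"
    proof (cases "y \<le> k")
      case True
      have "card (A \<inter> {..k}) \<le> card (insert x (?C \<inter> {..k} - {y}))"
        using fA y by (intro card_mono) auto
      also have "\<dots> \<le> Suc (card (?C \<inter> {..k} - {y}))" using fA by (simp add: card_insert_if)
      also have "\<dots> = card (?C \<inter> {..k})"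
        using True fA by (subst card.remove[of _ y]) auto
      finally show ?thesis using SA by simp
    next
      case False
      have "B \<inter> {..k} \<subseteq> ?C \<inter> {..k}"
        using False x ymin by fastforce
      then have "card (B \<inter> {..k}) \<le> card (?C \<inter> {..k})"
        using fA by (intro card_mono) auto
      then show ?thesis using SB by simp
    qed
  qed
  then show "\<exists>y\<in>B - A. insert y (A - {x}) \<in> schubert_bases N S"
    using y by blast
qed simp

lemma is_matroid_catalan: "is_matroid {1..n * (a + b)} (catalan_bases a b n)"
  unfolding catalan_bases_def by (rule is_matroid_schubert) (auto simp: catalan_set_def)

end

theory Submission
  imports Defs "HOL-Computational_Algebra.Polynomial_FPS"
begin

text \<open>
  A lattice point of \<open>t P(SM(S))\<close> is a word in \<open>{0..t}\<close> whose prefix sums dominate those of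
  \<open>t e\<^sub>S\<close>. For the Catalan set, cutting the word into \<open>n\<close> blocks of length \<open>m = a + b\<close> and giving each block
  its sum minus \<open>t b\<close> as weight turns these words into nonnegative walks from 0 to 0. Rotating
  at the last minimum gives \<open>n A\<^sub>n = (\<Sum>k=1..n. A\<^sub>n\<^sub>-\<^sub>k B\<^sub>k)\<close>, where \<open>A\<^sub>n\<close> counts the nonnegative walks and
  \<open>B\<^sub>k\<close> all walks from 0 to 0, that is, the lattice points of \<open>t\<close> times the hypersimplex
  \<open>\<Delta>(k b, k m)\<close>. So positivity reduces to that of hypersimplices (Ferroni's theorem).

  For the hypersimplex \<open>\<Delta>(k, N)\<close>, expanding \<open>((1 - z\<^sup>t\<^sup>+\<^sup>1) / (1 - z))\<^sup>N\<close> gives an alternating sum over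
  \<open>j < k\<close> of polynomials in \<open>s = (k - j) t\<close>, whose \<open>j\<close>-th summand is \<open>N / s\<close> times the coefficient of
  \<open>u\<^sup>N x\<^sup>j\<close> in \<open>((1 - u x) / (1 - u))\<^sup>s\<close>. The logarithm of \<open>(1 - u x) / (1 - u)\<close> is \<open>1 - x\<close> times the series
  \<open>\<Sum>i\<ge>1. u\<^sup>i (1 + x + \<dots> + x\<^sup>i\<^sup>-\<^sup>1) / i\<close> with nonnegative coefficients. The remaining powers of
  \<open>1 - x\<close> are absorbed by \<open>\<Sum>i\<ge>1. i\<^sup>m x\<^sup>i\<close>, which they turn into an Eulerian polynomial.
\<close>

section \<open>Excursions and bridges\<close>

definition bridges :: "('a \<Rightarrow> int) \<Rightarrow> 'a set \<Rightarrow> nat \<Rightarrow> 'a list set" where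
  "bridges v S n = {xs. set xs \<subseteq> S \<and> length xs = n \<and> sum_list (map v xs) = 0}"

definition excursions :: "('a \<Rightarrow> int) \<Rightarrow> 'a set \<Rightarrow> nat \<Rightarrow> 'a list set" where
  "excursions v S n = {xs \<in> bridges v S n. \<forall>p q. xs = p @ q \<longrightarrow> sum_list (map v p) \<ge> 0}"

text \<open>A triple \<open>(e, p, r)\<close> encodes both an excursion \<open>e @ p @ r\<close> with a mark at the end of \<open>p\<close>, where
  \<open>e\<close> ends at the last zero before the mark, and an excursion \<open>e\<close> with a bridge \<open>r @ p\<close>, where \<open>r\<close> ends
  at the last minimum before the final position.\<close>

definition split_walks :: "('a \<Rightarrow> int) \<Rightarrow> 'a set \<Rightarrow> nat \<Rightarrow> ('a list \<times> 'a list \<times> 'a list) set" where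
  "split_walks v S n = {(e, p, r). e \<in> excursions v S (length e) \<and> p \<noteq> [] \<and>
     (\<forall>p1 p2. p = p1 @ p2 \<longrightarrow> p1 \<noteq> [] \<longrightarrow> p2 \<noteq> [] \<longrightarrow> sum_list (map v p1) > 0) \<and>
     p @ r \<in> excursions v S (length p + length r) \<and> length e + length p + length r = n}"

lemma finite_bridges: "finite S \<Longrightarrow> finite (bridges v S n)"
  by (rule finite_subset[OF _ finite_lists_length_eq[of S n]]) (auto simp: bridges_def)

lemma finite_excursions: "finite S \<Longrightarrow> finite (excursions v S n)"
  by (rule finite_subset[OF _ finite_bridges[of S v n]]) (auto simp: excursions_def)

lemma append_in_excursions_iff:
  assumes "sum_list (map v e) = 0"
  shows "e @ f \<in> excursions v S (length e + length f) \<longleftrightarrow>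
    e \<in> excursions v S (length e) \<and> f \<in> excursions v S (length f)"
proof
  assume ef: "e @ f \<in> excursions v S (length e + length f)"
  have pos: "sum_list (map v p) \<ge> 0" if "e @ f = p @ q" for p q
    using ef that by (auto simp: excursions_def)
  have "sum_list (map v p) \<ge> 0" if "e = p @ q" for p q
    using pos[of p "q @ f"] that by simp
  moreover have "sum_list (map v p) \<ge> 0" if "f = p @ q" for p q
    using pos[of "e @ p" q] that assms by simp
  ultimately show "e \<in> excursions v S (length e) \<and> f \<in> excursions v S (length f)"
    using ef assms by (auto simp: excursions_def bridges_def)
next
  assume *: "e \<in> excursions v S (length e) \<and> f \<in> excursions v S (length f)"
  have "sum_list (map v p) \<ge> 0" if "e @ f = p @ q" for p q
    using that * by (auto simp: append_eq_append_conv2 excursions_def bridges_def)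
  then show "e @ f \<in> excursions v S (length e + length f)"
    using * by (auto simp: excursions_def bridges_def)
qed

lemma split_walks_sums:
  assumes "(e, p, r) \<in> split_walks v S n"
  shows "sum_list (map v e) = 0" "sum_list (map v p) + sum_list (map v r) = 0"
  using assms by (auto simp: split_walks_def excursions_def bridges_def)

text \<open>A marked excursion determines its triple: since \<open>p\<close> stays positive inside,
  \<open>e\<close> must end at the last zero strictly before the mark. As the mark ranges over
  \<open>{1..n}\<close>, each excursion is counted \<open>n\<close> times.\<close>

lemma bij_betw_split_walks_marked:
  "bij_betw (\<lambda>(e, p, r). (e @ p @ r, length e + length p))
     (split_walks v S n) (excursions v S n \<times> {1..n})"
  unfolding bij_betw_def
proof
  let ?f = "\<lambda>(e, p, r). (e @ p @ r, length e + length p)"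
  \<comment> \<open>If \<open>e'\<close> were longer, the part of \<open>p\<close> leading to the
    end of \<open>e'\<close> would have sum 0, although it is a nonempty proper prefix of
    \<open>p\<close>.\<close>
  have no: "\<not> length e < length e'"
    if X: "(e, p, r) \<in> split_walks v S n" and Y: "(e', p', r') \<in> split_walks v S n"
      and eq: "e @ p @ r = e' @ p' @ r'" and len: "length e + length p = length e' + length p'"
    for e p r e' p' r' :: "'a list"
  proof
    assume l: "length e < length e'"
    have ep: "e @ p = e' @ p'"
      using eq len append_eq_append_conv[of "e @ p" "e' @ p'" r r'] by simp
    then obtain s where s: "e' = e @ s" "p = s @ p'"
      using l by (auto simp: append_eq_append_conv2)
    have "s \<noteq> []" "p' \<noteq> []" using s l Y by (auto simp: split_walks_def)
    then have "sum_list (map v s) > 0" using X s by (auto simp: split_walks_def)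
    then show False using split_walks_sums(1)[OF X] split_walks_sums(1)[OF Y] s by simp
  qed
  show "inj_on ?f (split_walks v S n)"
  proof (rule inj_onI)
    fix x y assume xy: "x \<in> split_walks v S n" "y \<in> split_walks v S n" "?f x = ?f y"
    obtain e p r e' p' r' where x: "x = (e, p, r)" and y: "y = (e', p', r')"
      by (metis prod_cases3)
    have X: "(e, p, r) \<in> split_walks v S n" and Y: "(e', p', r') \<in> split_walks v S n"
      and eq: "e @ p @ r = e' @ p' @ r'" and len: "length e + length p = length e' + length p'"
      using xy x y by auto
    have "length e = length e'"
      using no[OF X Y eq len] no[OF Y X eq[symmetric] len[symmetric]] by simp
    then show "x = y" using eq len x y by simp
  qed
  show "?f ` split_walks v S n = excursions v S n \<times> {1..n}"
  proof (intro equalityI subsetI)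
    fix y assume "y \<in> ?f ` split_walks v S n"
    then obtain e p r where X: "(e, p, r) \<in> split_walks v S n" and y: "y = ?f (e, p, r)" by auto
    have "e @ p @ r \<in> excursions v S (length e + length (p @ r))"
      using X split_walks_sums(1)[OF X] by (subst append_in_excursions_iff) (auto simp: split_walks_def)
    then show "y \<in> excursions v S n \<times> {1..n}"
      using X y by (auto simp: split_walks_def add.assoc Suc_le_eq)
  next
    fix y assume "y \<in> excursions v S n \<times> {1..n}"
    then obtain w i where y: "y = (w, i)" and w: "w \<in> excursions v S n" and i: "1 \<le> i" "i \<le> n" by auto
    have lw: "length w = n" using w by (simp add: excursions_def bridges_def)
    let ?Q = "\<lambda>c. c < i \<and> sum_list (map v (take c w)) = 0"
    define c where "c = Greatest ?Q"
    have c: "?Q c" unfolding c_def by (rule GreatestI_nat[of ?Q 0 i]) (use i in auto)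
    have cmax: "d \<le> c" if "?Q d" for d
      unfolding c_def by (rule Greatest_le_nat[of ?Q d i]) (use that in auto)
    let ?e = "take c w" and ?p = "drop c (take i w)" and ?r = "drop i w"
    have epr: "?e @ ?p @ ?r = w" using c i lw
      by (metis append.assoc append_take_drop_id min.absorb2 nat_less_le take_take min.commute)
    have le: "length ?e = c" "length ?p = i - c" "length ?r = n - i" using c i lw by auto
    have "?e @ (?p @ ?r) \<in> excursions v S (length ?e + length (?p @ ?r))"
      using w epr le c i by simp
    then have ex: "?e \<in> excursions v S (length ?e)" "?p @ ?r \<in> excursions v S (length (?p @ ?r))"
      using append_in_excursions_iff[of v ?e "?p @ ?r" S] c by auto
    have "sum_list (map v p1) > 0" if p: "?p = p1 @ p2" "p1 \<noteq> []" "p2 \<noteq> []" for p1 p2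
    proof -
      let ?d = "c + length p1"
      have "w = (?e @ p1) @ (p2 @ ?r)" using epr p(1) by simp
      then have td: "take ?d w = ?e @ p1"
        using le by (metis append_eq_conv_conj length_append)
      have "length p1 + length p2 = i - c" using p(1) le by (metis length_append)
      then have "?d < i" "c < ?d" using p by (auto simp: length_greater_0_conv[symmetric] simp del: length_greater_0_conv)
      then have "sum_list (map v (?e @ p1)) \<noteq> 0" using cmax[of ?d] td by auto
      moreover have "sum_list (map v (?e @ p1)) \<ge> 0"
        using w \<open>w = (?e @ p1) @ (p2 @ ?r)\<close> unfolding excursions_def by blast
      ultimately show ?thesis using c by simp
    qed
    moreover have "?p \<noteq> []" using c i lw by simp
    ultimately have "(?e, ?p, ?r) \<in> split_walks v S n"
      using ex le c i unfolding split_walks_def by simp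
    moreover have "y = ?f (?e, ?p, ?r)" using y epr le c by simp
    ultimately show "y \<in> ?f ` split_walks v S n" by blast
  qed
qed

text \<open>A cycle-lemma argument, with \<open>e\<close> carried along: rotating a bridge at a
  minimum makes it an excursion, and taking the last minimum makes \<open>p\<close> strictly
  positive inside, so that the rotation can be undone.\<close>

lemma bij_betw_split_walks_bridge:
  "bij_betw (\<lambda>(e, p, r). (length p + length r, e, r @ p))
     (split_walks v S n) (SIGMA k:{1..n}. excursions v S (n - k) \<times> bridges v S k)"
  unfolding bij_betw_def
proof
  let ?f = "\<lambda>(e, p, r). (length p + length r, e, r @ p)"
  \<comment> \<open>Here \<open>r' = r @ s\<close> with \<open>s\<close> of positive sum, so
    \<open>p' @ r\<close>, a prefix of the excursion \<open>p' @ r'\<close> of total 0, would have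
    negative sum.\<close>
  have no: "\<not> length r < length r'"
    if X: "(e, p, r) \<in> split_walks v S n" and Y: "(e', p', r') \<in> split_walks v S n"
      and eq: "r @ p = r' @ p'"
    for e p r e' p' r' :: "'a list"
  proof
    assume l: "length r < length r'"
    then obtain s where s: "r' = r @ s" "p = s @ p'"
      using eq by (auto simp: append_eq_append_conv2)
    have "s \<noteq> []" "p' \<noteq> []" using s l Y by (auto simp: split_walks_def)
    then have "sum_list (map v s) > 0" using X s by (auto simp: split_walks_def)
    moreover have "p' @ r' = (p' @ r) @ s" using s by simp
    then have "sum_list (map v (p' @ r)) \<ge> 0"
      using Y unfolding split_walks_def excursions_def by blast
    ultimately show False using split_walks_sums(2)[OF Y] s by simp
  qed
  show "inj_on ?f (split_walks v S n)"
  proof (rule inj_onI)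
    fix x y assume xy: "x \<in> split_walks v S n" "y \<in> split_walks v S n" "?f x = ?f y"
    obtain e p r e' p' r' where x: "x = (e, p, r)" and y: "y = (e', p', r')"
      by (metis prod_cases3)
    have X: "(e, p, r) \<in> split_walks v S n" and Y: "(e', p', r') \<in> split_walks v S n"
      and eq: "r @ p = r' @ p'" and e: "e = e'"
      using xy x y by auto
    have "length r = length r'"
      using no[OF X Y eq] no[OF Y X eq[symmetric]] by simp
    then show "x = y" using eq e x y by simp
  qed
  show "?f ` split_walks v S n = (SIGMA k:{1..n}. excursions v S (n - k) \<times> bridges v S k)"
  proof (intro equalityI subsetI)
    fix y assume "y \<in> ?f ` split_walks v S n"
    then show "y \<in> (SIGMA k:{1..n}. excursions v S (n - k) \<times> bridges v S k)"
      by (auto simp: split_walks_def excursions_def bridges_def Suc_le_eq)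
  next
    fix y assume "y \<in> (SIGMA k:{1..n}. excursions v S (n - k) \<times> bridges v S k)"
    then obtain k e w where y: "y = (k, e, w)" and k: "1 \<le> k" "k \<le> n"
      and e: "e \<in> excursions v S (n - k)" and w: "w \<in> bridges v S k" by auto
    have lw: "length w = k" and le: "length e = n - k"
      using w e by (auto simp: excursions_def bridges_def)
    let ?s = "\<lambda>c. sum_list (map v (take c w))"
    have fin: "finite (?s ` {..<k})" and ne: "?s ` {..<k} \<noteq> {}" using k by (auto simp: lessThan_empty_iff)
    obtain c0 where c0: "c0 < k" "\<forall>d<k. ?s c0 \<le> ?s d"
    proof -
      obtain c0 where "c0 < k" "?s c0 = Min (?s ` {..<k})"
        using Min_in[OF fin ne] by auto
      moreover have "\<forall>d<k. Min (?s ` {..<k}) \<le> ?s d" using fin by auto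
      ultimately show ?thesis using that by metis
    qed
    \<comment> \<open>The final position is excluded so that \<open>p\<close> is nonempty. It has
      height 0 like position 0, so the minimum over the other positions is still the global
      one.\<close>
    let ?Q = "\<lambda>c. c < k \<and> ?s c = ?s c0"
    define c where "c = Greatest ?Q"
    have c: "?Q c" unfolding c_def by (rule GreatestI_nat[of ?Q c0 k]) (use c0 in auto)
    have cmin: "?s c \<le> ?s d" if "d < k" for d using c c0 that by simp
    have cmin': "?s c < ?s d" if "c < d" "d < k" for d
    proof -
      have "d \<le> c" if "?Q d"
        unfolding c_def by (rule Greatest_le_nat[of ?Q d k]) (use that in auto)
      then show ?thesis using that c cmin[of d] by fastforce
    qed
    have w0: "?s k = 0" using w lw by (simp add: bridges_def)
    have cmink: "?s c \<le> ?s d" for d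
      using cmin[of d] cmin[of 0] w0 lw k by (cases "d < k") auto
    let ?p = "drop c w" and ?r = "take c w"
    have rp: "?r @ ?p = w" by simp
    have tot: "sum_list (map v ?r) + sum_list (map v ?p) = 0"
      using w by (metis (mono_tags, lifting) bridges_def map_append mem_Collect_eq rp sum_list_append)
    have pos1: "sum_list (map v p1) > 0" if p: "?p = p1 @ p2" "p1 \<noteq> []" "p2 \<noteq> []" for p1 p2
    proof -
      let ?d = "c + length p1"
      have "w = (?r @ p1) @ p2" using p(1) rp by (metis append.assoc)
      then have td: "take ?d w = ?r @ p1"
        using lw c by (metis append_eq_conv_conj length_append length_take min.absorb2 nat_less_le)
      have "length p1 + length p2 = k - c" using p(1) lw by (metis length_append length_drop)
      then have "?d < k" "c < ?d" using p by (auto simp: length_greater_0_conv[symmetric] simp del: length_greater_0_conv)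
      then show ?thesis using cmin'[of ?d] td by auto
    qed
    have "sum_list (map v p1) \<ge> 0" if "?p @ ?r = p1 @ p2" for p1 p2
    proof -
      from that consider s where "?p = p1 @ s" | s where "p1 = ?p @ s" "?r = s @ p2"
        by (auto simp: append_eq_append_conv2)
      then show ?thesis
      proof cases
        case 1
        then have "w = (?r @ p1) @ s" using rp by (metis append.assoc)
        then have td: "take (c + length p1) w = ?r @ p1"
          using lw c by (metis append_eq_conv_conj length_append length_take min.absorb2 nat_less_le)
        then show ?thesis using cmink[of "c + length p1"] by simp
      next
        case 2
        then have "take (length s) w = s" using rp by (metis append_eq_conv_conj append.assoc)
        then show ?thesis using cmink[of "length s"] 2 tot by simp
      qed
    qed
    then have "?p @ ?r \<in> excursions v S k"
      using w lw c tot set_take_subset[of c w] set_drop_subset[of c w]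
      by (auto simp: excursions_def bridges_def)
    moreover have "?p \<noteq> []" using c lw by simp
    ultimately have "(e, ?p, ?r) \<in> split_walks v S n"
      using e le lw c k pos1 unfolding split_walks_def by simp
    moreover have "y = ?f (e, ?p, ?r)" using y lw c by simp
    ultimately show "y \<in> ?f ` split_walks v S n" by blast
  qed
qed

text \<open>Both sides count \<open>split_walks\<close>. The right side has no subtraction, so
  positivity can pass from bridges to excursions.\<close>

theorem card_excursions_rec:
  assumes "finite S"
  shows "n * card (excursions v S n) =
    (\<Sum>k=1..n. card (excursions v S (n - k)) * card (bridges v S k))"
proof -
  have "n * card (excursions v S n) = card (split_walks v S n)"
    using bij_betw_same_card[OF bij_betw_split_walks_marked[of v S n]] by (simp add: card_cartesian_product)
  also have "\<dots> = card (SIGMA k:{1..n}. excursions v S (n - k) \<times> bridges v S k)"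
    by (rule bij_betw_same_card[OF bij_betw_split_walks_bridge])
  also have "\<dots> = (\<Sum>k=1..n. card (excursions v S (n - k)) * card (bridges v S k))"
    using assms by (subst card_SigmaI)
      (auto simp: card_cartesian_product intro!: finite_cartesian_product finite_excursions finite_bridges)
  finally show ?thesis .
qed

section \<open>Lattice points of Schubert matroid polytopes\<close>

lemma lookup_scaleR_poly_mapping:
  "Poly_Mapping.lookup (r *\<^sub>R x) i = r * Poly_Mapping.lookup x i" for x :: "'a \<Rightarrow>\<^sub>0 real"
proof -
  have "finite {i. r * Poly_Mapping.lookup x i \<noteq> 0}"
    by (rule finite_subset[OF _ finite_lookup[of x]]) auto
  then show ?thesis by (simp add: scaleR_poly_mapping_def)
qed

text \<open>A form of Hermite's identity: replacing \<open>X\<close> by \<open>X + 1\<close> shifts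
  the window of summands, dropping \<open>X div t\<close> and adding \<open>(X + t) div t\<close>,
  which is one larger.\<close>

lemma sum_add_div_shift:
  fixes X t :: nat
  assumes "t > 0"
  shows "(\<Sum>r<t. (X + r) div t) = X"
proof (induction X)
  case 0
  then show ?case by simp
next
  case (Suc X)
  have "(\<Sum>r<t. (Suc X + r) div t) + X div t = (\<Sum>r<Suc t. (X + r) div t)"
    by (subst sum.lessThan_Suc_shift) simp
  also have "\<dots> = X + (X + t) div t" by (simp add: Suc.IH)
  also have "(X + t) div t = Suc (X div t)" using assms by simp
  finally show ?case by simp
qed

definition schubert_words :: "nat \<Rightarrow> nat set \<Rightarrow> nat \<Rightarrow> nat list set" where
  "schubert_words N S t = {xs. set xs \<subseteq> {..t} \<and> length xs = N \<and> sum_list xs = t * card S \<and>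
     (\<forall>k\<le>N. t * card (S \<inter> {..k}) \<le> sum_list (take k xs))}"

definition word_vector :: "nat list \<Rightarrow> (nat \<Rightarrow>\<^sub>0 real)" where
  "word_vector xs = (\<Sum>i\<in>{1..length xs}. Poly_Mapping.single i (real (xs ! (i - 1))))"

lemma lookup_word_vector:
  "Poly_Mapping.lookup (word_vector xs) i =
     (if 1 \<le> i \<and> i \<le> length xs then real (xs ! (i - 1)) else 0)"
  by (auto simp: word_vector_def lookup_sum lookup_single when_def)

lemma real_sum_list_take:
  assumes "k \<le> length xs"
  shows "real (sum_list (take k xs)) = (\<Sum>i\<in>{1..k}. Poly_Mapping.lookup (word_vector xs) i)"
  using assms
proof (induction k)
  case (Suc k)
  then have "take (Suc k) xs = take k xs @ [xs ! k]" by (simp add: take_Suc_conv_app_nth)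
  then show ?case using Suc by (simp add: lookup_word_vector)
qed simp

text \<open>The word is split into the indicator vectors of \<open>t\<close> bases, so its vector is
  \<open>t\<close> times their average.\<close>

lemma word_in_scaled_polytope:
  assumes S: "S \<subseteq> {1..N}" and t: "t > 0" and xs: "xs \<in> schubert_words N S t"
  shows "word_vector xs \<in> (\<lambda>x. real t *\<^sub>R x) ` matroid_polytope (schubert_bases N S)"
proof -
  have len: "length xs = N" and tot: "sum_list xs = t * card S" and sub: "set xs \<subseteq> {..t}"
    and pre: "\<And>k. k \<le> N \<Longrightarrow> t * card (S \<inter> {..k}) \<le> sum_list (take k xs)"
    using xs by (auto simp: schubert_words_def)
  have ub: "xs ! i \<le> t" if "i < N" for i
    using that sub len nth_mem[of i xs] by (metis atMost_iff subsetD)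
  \<comment> \<open>Deal out the units of \<open>xs\<close>, read from left to right, to \<open>t\<close> classes in cyclic order. Each class
    is then a basis, and \<open>g r k\<close> counts the units of class \<open>r\<close> among the first \<open>k\<close> letters.\<close>
  define g where "g = (\<lambda>r k. (sum_list (take k xs) + r) div t)"
  define B where "B = (\<lambda>r. {k \<in> {1..N}. g r k = Suc (g r (k - 1))})"
  have step: "sum_list (take (Suc k) xs) = sum_list (take k xs) + xs ! k" if "k < N" for k
    using that len by (simp add: take_Suc_conv_app_nth)
  \<comment> \<open>A letter is at most \<open>t\<close>, so it gives each class at most one
    unit.\<close>
  have g_step: "g r (Suc k) = g r k + (if Suc k \<in> B r then 1 else 0)" if "k < N" for r k
  proof -
    have "g r k \<le> g r (Suc k)" unfolding g_def step[OF that] by (intro div_le_mono) simp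
    moreover have "g r (Suc k) \<le> (sum_list (take k xs) + r + t) div t"
      unfolding g_def step[OF that] using ub[OF that] by (intro div_le_mono) simp
    then have "g r (Suc k) \<le> Suc (g r k)" using t by (simp add: g_def)
    ultimately show ?thesis using that by (auto simp: B_def)
  qed
  have card_B: "card (B r \<inter> {..k}) = g r k" if "k \<le> N" "r < t" for r k
    using that(1)
  proof (induction k)
    case 0
    have "B r \<inter> {..0} = {}" by (auto simp: B_def)
    then show ?case using that by (simp add: g_def)
  next
    case (Suc k)
    have "B r \<inter> {..Suc k} = (if Suc k \<in> B r then insert (Suc k) (B r \<inter> {..k}) else B r \<inter> {..k})"
      by (auto simp: le_Suc_eq)
    then show ?case using Suc g_step[of k r] by simp
  qed
  have fS: "finite S" using S finite_subset by blast
  \<comment> \<open>The prefix bounds survive the floor division by \<open>t\<close>, and the total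
    \<open>t * card S + r\<close> with \<open>r < t\<close> leaves exactly \<open>card S\<close>
    elements.\<close>
  have base: "B r \<in> schubert_bases N S" if r: "r < t" for r
    unfolding schubert_bases_iff_card[OF fS]
  proof (intro conjI allI)
    show sub: "B r \<subseteq> {1..N}" by (auto simp: B_def)
    have "card (B r) = card (B r \<inter> {..N})" using sub by (intro arg_cong[where f = card]) auto
    also have "\<dots> = (t * card S + r) div t" using card_B[of N r] r tot len by (simp add: g_def)
    also have "\<dots> = card S" using r by simp
    finally show cB: "card (B r) = card S" .
    fix k
    show "card (S \<inter> {..k}) \<le> card (B r \<inter> {..k})"
    proof (cases "k \<le> N")
      case True
      have "card (S \<inter> {..k}) = (t * card (S \<inter> {..k})) div t" using t by simp
      also have "\<dots> \<le> g r k" unfolding g_def using pre[OF True] by (intro div_le_mono) simp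
      finally show ?thesis using card_B[OF True r] by simp
    next
      case False
      then have "S \<inter> {..k} = S" "B r \<inter> {..k} = B r" using S sub by auto
      then show ?thesis using cB by simp
    qed
  qed
  define y where "y = (\<Sum>r<t. (1 / real t) *\<^sub>R indicator_vector (B r))"
  have fB: "finite (B r)" for r by (simp add: B_def)
  have "y \<in> matroid_polytope (schubert_bases N S)"
    unfolding y_def matroid_polytope_def
    by (rule convex_sum) (use t base in \<open>auto intro: hull_inc convex_convex_hull\<close>)
  moreover have "word_vector xs = real t *\<^sub>R y"
  proof (rule poly_mapping_eqI)
    fix i
    have y: "Poly_Mapping.lookup (real t *\<^sub>R y) i = (\<Sum>r<t. if i \<in> B r then 1 else 0)"
      using t by (simp add: y_def lookup_scaleR_poly_mapping lookup_sum lookup_indicator_vector[OF fB] sum_distrib_left)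
    show "Poly_Mapping.lookup (word_vector xs) i = Poly_Mapping.lookup (real t *\<^sub>R y) i"
    proof (cases "1 \<le> i \<and> i \<le> N")
      case False
      then show ?thesis unfolding y lookup_word_vector len by (auto simp: B_def)
    next
      case True
      then obtain k where k: "i = Suc k" "k < N" by (cases i) auto
      \<comment> \<open>By \<open>sum_add_div_shift\<close> the class counts of a prefix add up to
        its sum, so the letter at \<open>k\<close> is the number of classes that contain
        \<open>Suc k\<close>.\<close>
      have "sum_list (take k xs) + xs ! k = (\<Sum>r<t. g r (Suc k))"
        unfolding g_def sum_add_div_shift[OF t] using step[OF k(2)] by simp
      also have "\<dots> = sum_list (take k xs) + (\<Sum>r<t. if i \<in> B r then 1 else 0)"
        using sum_add_div_shift[OF t] by (simp add: g_step[OF k(2)] sum.distrib k(1)) (simp add: g_def)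
      finally have "xs ! k = (\<Sum>r<t. if i \<in> B r then 1 else 0)" by simp
      then have "real (xs ! k) = (\<Sum>r<t. if i \<in> B r then 1 else 0)"
        by (simp add: of_nat_sum if_distrib cong: if_cong)
      then show ?thesis unfolding y lookup_word_vector len using k by simp
    qed
  qed
  ultimately show ?thesis by blast
qed

text \<open>The conditions cut out a convex set, so it is enough to check them at the indicator
  vectors of bases.\<close>

lemma matroid_polytope_schubert_constraints:
  assumes S: "S \<subseteq> {1..N}" and x: "x \<in> matroid_polytope (schubert_bases N S)"
  shows "\<forall>i. 0 \<le> Poly_Mapping.lookup x i \<and> Poly_Mapping.lookup x i \<le> 1"
    and "\<forall>i. i \<notin> {1..N} \<longrightarrow> Poly_Mapping.lookup x i = 0"
    and "(\<Sum>i\<in>{1..N}. Poly_Mapping.lookup x i) = real (card S)"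
    and "\<forall>k\<le>N. real (card (S \<inter> {..k})) \<le> (\<Sum>i\<in>{1..k}. Poly_Mapping.lookup x i)"
proof -
  let ?l = "Poly_Mapping.lookup"
  let ?P = "{x. (\<forall>i. 0 \<le> ?l x i \<and> ?l x i \<le> 1) \<and> (\<forall>i. i \<notin> {1..N} \<longrightarrow> ?l x i = (0::real)) \<and>
    (\<Sum>i\<in>{1..N}. ?l x i) = real (card S) \<and>
    (\<forall>k\<le>N. real (card (S \<inter> {..k})) \<le> (\<Sum>i\<in>{1..k}. ?l x i))}"
  have fS: "finite S" using S finite_subset by blast
  have "convex ?P"
  proof (rule convexI)
    fix x y :: "nat \<Rightarrow>\<^sub>0 real" and u v :: real
    assume x: "x \<in> ?P" and y: "y \<in> ?P" and uv: "0 \<le> u" "0 \<le> v" "u + v = 1"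
    have l: "?l (u *\<^sub>R x + v *\<^sub>R y) i = u * ?l x i + v * ?l y i" for i
      by (simp add: lookup_add lookup_scaleR_poly_mapping)
    have s: "(\<Sum>i\<in>A. u * ?l x i + v * ?l y i) = u * (\<Sum>i\<in>A. ?l x i) + v * (\<Sum>i\<in>A. ?l y i)" for A
      by (simp add: sum.distrib sum_distrib_left)
    have "u * ?l x i + v * ?l y i \<le> 1" for i
      using x y uv by (intro convex_bound_le) auto
    moreover have "u * real (card S) + v * real (card S) = real (card S)"
      using uv by (simp flip: distrib_right)
    moreover have "c \<le> u * p + v * q" if "c \<le> p" "c \<le> q" for c p q :: real
    proof -
      have "u * c + v * c \<le> u * p + v * q" using that uv by (intro add_mono mult_left_mono) auto
      then show ?thesis using uv by (simp flip: distrib_right)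
    qed
    ultimately show "u *\<^sub>R x + v *\<^sub>R y \<in> ?P"
      using x y uv by (simp add: l s)
  qed
  moreover have "indicator_vector T \<in> ?P" if T: "T \<in> schubert_bases N S" for T
  proof -
    have T': "T \<subseteq> {1..N}" "card T = card S" "\<And>k. card (S \<inter> {..k}) \<le> card (T \<inter> {..k})"
      using T unfolding schubert_bases_iff_card[OF fS] by auto
    have fT: "finite T" using T' finite_subset by blast
    have "{1..k} \<inter> T = T \<inter> {..k}" for k using T' by auto
    then have "(\<Sum>i\<in>{1..k}. ?l (indicator_vector T) i) = real (card (T \<inter> {..k}))" for k
      by (simp add: lookup_indicator_vector[OF fT] sum.If_cases Int_def)
    moreover have "T \<inter> {..N} = T" using T' by auto
    ultimately show ?thesis using T' by (auto simp: lookup_indicator_vector[OF fT])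
  qed
  ultimately have "matroid_polytope (schubert_bases N S) \<subseteq> ?P"
    unfolding matroid_polytope_def by (intro hull_minimal) auto
  with x have "x \<in> ?P" by blast
  then show "\<forall>i. 0 \<le> ?l x i \<and> ?l x i \<le> 1"
    and "\<forall>i. i \<notin> {1..N} \<longrightarrow> ?l x i = 0"
    and "(\<Sum>i\<in>{1..N}. ?l x i) = real (card S)"
    and "\<forall>k\<le>N. real (card (S \<inter> {..k})) \<le> (\<Sum>i\<in>{1..k}. ?l x i)" by auto
qed

text \<open>Dealing out units puts every word into the dilated polytope; conversely, the constraints
  on the polytope force the coordinates of an integer point to form such a word.\<close>

theorem card_scaled_schubert_polytope:
  assumes S: "S \<subseteq> {1..N}" and t: "t > 0"
  shows "card ((\<lambda>x. real t *\<^sub>R x) ` matroid_polytope (schubert_bases N S) \<inter> integer_points N) =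
    card (schubert_words N S t)"
proof -
  let ?l = "Poly_Mapping.lookup"
  let ?Q = "(\<lambda>x. real t *\<^sub>R x) ` matroid_polytope (schubert_bases N S) \<inter> integer_points N"
  have "inj_on word_vector (schubert_words N S t)"
  proof (rule inj_onI)
    fix xs ys assume *: "xs \<in> schubert_words N S t" "ys \<in> schubert_words N S t" "word_vector xs = word_vector ys"
    then have len: "length xs = N" "length ys = N" by (auto simp: schubert_words_def)
    show "xs = ys"
    proof (rule nth_equalityI)
      fix i assume "i < length xs"
      moreover have "?l (word_vector xs) (Suc i) = ?l (word_vector ys) (Suc i)" using * by simp
      ultimately show "xs ! i = ys ! i" using len by (simp add: lookup_word_vector Suc_le_eq)
    qed (simp add: len)
  qed
  moreover have "word_vector ` schubert_words N S t = ?Q"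
  proof (intro equalityI subsetI)
    fix z assume "z \<in> word_vector ` schubert_words N S t"
    then obtain xs where xs: "xs \<in> schubert_words N S t" and z: "z = word_vector xs" by blast
    have "length xs = N" using xs by (simp add: schubert_words_def)
    then have "z \<in> integer_points N"
      by (auto simp: z integer_points_def in_keys_iff lookup_word_vector split: if_splits)
    then show "z \<in> ?Q" using word_in_scaled_polytope[OF S t xs] z by blast
  next
    fix z assume z: "z \<in> ?Q"
    then obtain x where x: "x \<in> matroid_polytope (schubert_bases N S)" and zx: "z = real t *\<^sub>R x" by blast
    note con = matroid_polytope_schubert_constraints[OF S x]
    have lz: "?l z i = real t * ?l x i" for i by (simp add: zx lookup_scaleR_poly_mapping)
    have z0: "?l z i = 0" if "i \<notin> {1..N}" for i using con(2) that by (simp add: lz)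
    have zb: "0 \<le> ?l z i" "?l z i \<le> real t" for i
      using con(1) t by (auto simp: lz mult_left_le)
    define xs where "xs = map (\<lambda>i. nat \<lfloor>?l z (Suc i)\<rfloor>) [0..<N]"
    have len: "length xs = N" by (simp add: xs_def)
    have zi: "real (nat \<lfloor>?l z i\<rfloor>) = ?l z i" if "i \<in> {1..N}" for i
    proof -
      have "?l z i \<in> \<int>" using z that by (auto simp: integer_points_def)
      then obtain m where "?l z i = of_int m" by (rule Ints_cases)
      then show ?thesis using zb[of i] by simp
    qed
    have zw: "word_vector xs = z"
    proof (rule poly_mapping_eqI)
      fix i show "?l (word_vector xs) i = ?l z i"
      proof (cases "i \<in> {1..N}")
        case True
        then have "xs ! (i - 1) = nat \<lfloor>?l z i\<rfloor>" by (auto simp: xs_def)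
        then show ?thesis using zi[OF True] True by (simp only: lookup_word_vector len) simp
      next
        case False
        then show ?thesis using z0[OF False] by (auto simp: lookup_word_vector len)
      qed
    qed
    have pre: "real (sum_list (take k xs)) = real t * (\<Sum>i\<in>{1..k}. ?l x i)" if "k \<le> N" for k
      using real_sum_list_take[of k xs] that len by (simp add: zw lz sum_distrib_left)
    have "sum_list xs = t * card S"
    proof -
      have "real (sum_list xs) = real (t * card S)" using pre[of N] con(3) len by simp
      then show ?thesis by (simp only: of_nat_eq_iff)
    qed
    moreover have "t * card (S \<inter> {..k}) \<le> sum_list (take k xs)" if "k \<le> N" for k
    proof -
      have "real (t * card (S \<inter> {..k})) \<le> real (sum_list (take k xs))"
        using pre[OF that] con(4) that by (simp add: mult_left_mono)
      then show ?thesis by (simp only: of_nat_le_iff)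
    qed
    moreover have "nat \<lfloor>?l z i\<rfloor> \<le> t" for i
    proof -
      have "\<lfloor>?l z i\<rfloor> \<le> \<lfloor>real t\<rfloor>" by (rule floor_mono) (rule zb)
      then show ?thesis by (simp add: nat_le_iff)
    qed
    then have "set xs \<subseteq> {..t}" by (auto simp: xs_def)
    ultimately have "xs \<in> schubert_words N S t" using len by (simp add: schubert_words_def)
    then show "z \<in> word_vector ` schubert_words N S t" using zw by blast
  qed
  ultimately have "bij_betw word_vector (schubert_words N S t) ?Q" by (simp add: bij_betw_def)
  from bij_betw_same_card[OF this] show ?thesis by simp
qed

section \<open>Ehrhart positivity of hypersimplices\<close>

text \<open>This is the coefficient of \<open>u^j\<close> in \<open>(1 - u)^(-s)\<close>. At
  \<open>-s\<close> it is that of \<open>(1 - u)^s\<close>, so one function serves numerator and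
  denominator.\<close>

definition rising :: "real \<Rightarrow> nat \<Rightarrow> real" where
  "rising s j = pochhammer s j / fact j"

lemma rising_0 [simp]: "rising s 0 = 1"
  by (simp add: rising_def)

lemma rising_Suc: "real (Suc j) * rising s (Suc j) = (s + real j) * rising s j"
proof -
  have "fact (Suc j) = real (Suc j) * fact j" by simp
  then show ?thesis by (simp add: rising_def pochhammer_rec' del: fact_Suc of_nat_Suc)
qed

text \<open>Coefficientwise this is \<open>u G' = s u / (1 - u) G\<close> for
  \<open>G = (1 - u)^(-s)\<close>.\<close>

lemma rising_rec: "real j * rising s j = s * (\<Sum>l<j. rising s l)"
proof (induction j)
  case (Suc j)
  then show ?case by (simp only: rising_Suc) (simp add: algebra_simps)
qed simp

text \<open>The coefficient of \<open>u\<^sup>N\<close> in \<open>((1 - u x) / (1 - u))\<^sup>s\<close>, as a polynomial in \<open>x\<close>.\<close>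

definition lah_series :: "real \<Rightarrow> nat \<Rightarrow> real poly" where
  "lah_series s N = (\<Sum>j\<le>N. monom (rising (-s) j * rising s (N - j)) j)"

lemma coeff_lah_series:
  "j \<le> N \<Longrightarrow> coeff (lah_series s N) j = rising (-s) j * rising s (N - j)"
  by (simp add: lah_series_def coeff_sum if_distrib cong: if_cong)

text \<open>Logarithmic differentiation in \<open>u\<close>: the derivative of
  \<open>s log ((1 - u x) / (1 - u))\<close> is \<open>s (1 / (1 - u) - x / (1 - u x))\<close>, with
  coefficients \<open>s (1 - x^(i+1))\<close>.\<close>

lemma lah_series_rec:
  "smult (real (Suc N)) (lah_series s (Suc N)) =
     smult s (\<Sum>i\<le>N. (1 - monom 1 (Suc i)) * lah_series s (N - i))"
proof -
  \<comment> \<open>As series in \<open>u\<close> over polynomials in \<open>x\<close>: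
    \<open>F = (1 - u x)^s\<close>, \<open>G = (1 - u)^(-s)\<close>, \<open>K = 1 / (1 - u)\<close>,
    \<open>L = x / (1 - u x)\<close>.\<close>
  define F :: "real poly fps" where "F = Abs_fps (\<lambda>j. monom (rising (-s) j) j)"
  define G :: "real poly fps" where "G = Abs_fps (\<lambda>j. [:rising s j:])"
  define K :: "real poly fps" where "K = Abs_fps (\<lambda>j. 1)"
  define L :: "real poly fps" where "L = Abs_fps (\<lambda>j. monom 1 (Suc j))"
  have FG: "fps_nth (F * G) n = lah_series s n" for n
  proof -
    have "monom a j * [:c:] = monom (a * c) j" for a c :: real and j
      by (simp flip: monom_0 add: mult_monom)
    then show ?thesis
      unfolding fps_mult_nth by (simp add: F_def G_def lah_series_def atLeast0AtMost)
  qed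
  have G': "fps_deriv G = fps_const [:s:] * (K * G)"
  proof (rule fps_ext)
    fix n
    have "fps_nth (fps_deriv G) n = [:real (Suc n) * rising s (Suc n):]"
      by (simp add: G_def of_nat_poly algebra_simps)
    also have "\<dots> = [:s * (\<Sum>l\<le>n. rising s l):]"
      by (simp only: rising_rec lessThan_Suc_atMost)
    also have "\<dots> = [:s:] * fps_nth (G * K) n"
    proof -
      have "fps_nth (G * K) n = (\<Sum>l\<le>n. [:rising s l:])"
        by (simp add: fps_mult_nth G_def K_def atLeast0AtMost)
      then show ?thesis by (simp add: poly_eq_iff coeff_sum coeff_pCons split: nat.splits)
    qed
    finally show "fps_nth (fps_deriv G) n = fps_nth (fps_const [:s:] * (K * G)) n" by (simp add: mult.commute)
  qed
  have F': "fps_deriv F = - fps_const [:s:] * (L * F)"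
  proof (rule fps_ext)
    fix n
    have "fps_nth (fps_deriv F) n = monom (real (Suc n) * rising (-s) (Suc n)) (Suc n)"
      by (simp add: F_def of_nat_poly smult_monom algebra_simps)
    also have "\<dots> = monom ((-s) * (\<Sum>l\<le>n. rising (-s) l)) (Suc n)"
      by (simp only: rising_rec lessThan_Suc_atMost)
    also have "\<dots> = [:-s:] * fps_nth (F * L) n"
      by (simp add: fps_mult_nth F_def L_def atLeast0AtMost mult_monom)
         (simp add: poly_eq_iff coeff_sum)
    finally show "fps_nth (fps_deriv F) n = fps_nth (- fps_const [:s:] * (L * F)) n" by (simp add: mult.commute)
  qed
  have "fps_deriv (F * G) = fps_const [:s:] * ((K - L) * (F * G))"
    unfolding fps_deriv_mult F' G' by (simp only: algebra_simps mult_minus_left mult_minus_right add.right_inverse add_0_left add_0_right)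
  then have "fps_nth (fps_deriv (F * G)) N = [:s:] * fps_nth ((K - L) * (F * G)) N" by simp
  also have "fps_nth ((K - L) * (F * G)) N = (\<Sum>i\<le>N. (1 - monom 1 (Suc i)) * lah_series s (N - i))"
    by (subst fps_mult_nth) (simp add: FG K_def L_def atLeast0AtMost)
  finally show ?thesis by (simp only: fps_deriv_nth FG) (simp add: of_nat_poly)
qed

section \<open>Expansion of \<open>lah_series\<close> in powers of \<open>s\<close>\<close>

lemma smult_sum_right: "smult c (\<Sum>i\<in>A. f i) = (\<Sum>i\<in>A. smult c (f i))"
  by (simp add: poly_eq_iff coeff_sum sum_distrib_left)

text \<open>The coefficient of \<open>u\<^sup>N\<close> in \<open>L\<^sup>m / m!\<close> for \<open>L = (\<Sum>i\<ge>1. u\<^sup>i (1 + x + \<dots> + x\<^sup>i\<^sup>-\<^sup>1) / i)\<close>.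
  For \<open>N = 0\<close> the factor \<open>1 / 0 = 0\<close> meets an empty sum.\<close>

primrec lah_poly :: "nat \<Rightarrow> nat \<Rightarrow> real poly" where
  "lah_poly 0 = (\<lambda>N. if N = 0 then 1 else 0)"
| "lah_poly (Suc m) = (\<lambda>N. smult (1 / real N)
     (\<Sum>i<N. (\<Sum>r\<le>i. monom 1 r) * lah_poly m (N - Suc i)))"

lemma lah_poly_eq_0: "N < m \<Longrightarrow> lah_poly m N = 0"
  by (induction m arbitrary: N) auto

lemma coeff_monom_sum: "coeff (\<Sum>r\<le>i. monom (1::real) r) j = (if j \<le> i then 1 else 0)"
  by (auto simp: coeff_sum)

lemma coeff_lah_poly_nonneg: "coeff (lah_poly m N) j \<ge> 0"
proof (induction m arbitrary: N j)
  case (Suc m)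
  then show ?case
    by (auto simp: coeff_sum coeff_mult intro!: sum_nonneg divide_nonneg_nonneg mult_nonneg_nonneg)
qed auto

lemma coeff_lah_poly_pos:
  assumes "1 \<le> m" "m \<le> N" "j \<le> N - m"
  shows "coeff (lah_poly m N) j > 0"
  using assms
proof (induction m arbitrary: N j)
  case (Suc m)
  let ?t = "\<lambda>i. coeff ((\<Sum>r\<le>i. monom 1 r) * lah_poly m (N - Suc i)) j"
  \<comment> \<open>For \<open>m = 0\<close> only \<open>lah_poly 0 0\<close> is nonzero, which
    forces \<open>i = N - 1\<close>. Otherwise \<open>i = 0\<close> gives the factor 1, and the
    induction hypothesis at \<open>N - 1\<close> covers the whole range of \<open>j\<close>.\<close>
  define i where "i = (if m = 0 then N - 1 else 0)"
  have "?t i > 0"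
  proof (cases "m = 0")
    case True
    then show ?thesis using Suc.prems by (simp add: i_def coeff_monom_sum)
  next
    case False
    then have "coeff (lah_poly m (N - Suc 0)) j > 0" using Suc.prems by (intro Suc.IH) auto
    then show ?thesis using False by (simp add: i_def)
  qed
  moreover have "?t l \<ge> 0" for l
    by (auto simp: coeff_mult coeff_monom_sum intro!: sum_nonneg mult_nonneg_nonneg coeff_lah_poly_nonneg)
  moreover have "i < N" using Suc.prems by (auto simp: i_def)
  ultimately have "(\<Sum>l<N. ?t l) > 0" by (intro sum_pos2[of _ i]) auto
  then show ?case using Suc.prems by (simp add: coeff_sum)
qed auto

text \<open>This is \<open>exp (s (1 - x) L)\<close> expanded, with \<open>L\<close> the series
  behind \<open>lah_poly\<close>. In \<open>lah_series_rec\<close> each \<open>1 - x^(i+1)\<close>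
  is \<open>1 - x\<close> times a geometric sum. This raises the powers of \<open>s\<close> and
  \<open>1 - x\<close> by one and leaves the recursion of \<open>lah_poly\<close>.\<close>

lemma lah_series_expansion:
  "lah_series s N = (\<Sum>m\<le>N. smult (s ^ m) ((1 - monom 1 1) ^ m * lah_poly m N))"
proof (induction N rule: less_induct)
  case (less N)
  show ?case
  proof (cases N)
    case 0
    then show ?thesis by (simp add: lah_series_def)
  next
    case (Suc n)
    let ?q = "\<lambda>i. (\<Sum>r\<le>i. monom 1 r) :: real poly"
    let ?x = "1 - monom 1 1 :: real poly"
    have q: "1 - monom 1 (Suc i) = ?x * ?q i" for i
    proof -
      have "(1::real poly) - monom 1 1 ^ Suc i = (1 - monom 1 1) * (\<Sum>r<Suc i. monom 1 1 ^ r)"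
        by (rule one_diff_power_eq)
      then show ?thesis by (simp only: monom_power lessThan_Suc_atMost) simp
    qed
    have IH: "lah_series s (n - i) = (\<Sum>m\<le>n. smult (s ^ m) (?x ^ m * lah_poly m (n - i)))" if "i \<le> n" for i
    proof -
      have "lah_series s (n - i) = (\<Sum>m\<le>n - i. smult (s ^ m) (?x ^ m * lah_poly m (n - i)))"
        using Suc by (intro less.IH) auto
      \<comment> \<open>The added terms vanish; a range independent of \<open>i\<close> permits the
        interchange of sums below.\<close>
      also have "\<dots> = (\<Sum>m\<le>n. smult (s ^ m) (?x ^ m * lah_poly m (n - i)))"
        by (rule sum.mono_neutral_left) (auto simp: lah_poly_eq_0)
      finally show ?thesis .
    qed
    have "smult (real N) (lah_series s N) =
        smult s (\<Sum>i\<le>n. (?x * ?q i) * (\<Sum>m\<le>n. smult (s ^ m) (?x ^ m * lah_poly m (n - i))))"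
      using IH unfolding Suc lah_series_rec q by (intro arg_cong2[where f = smult] sum.cong) auto
    also have "\<dots> = (\<Sum>i\<le>n. \<Sum>m\<le>n. smult (s ^ Suc m) (?x ^ Suc m * (?q i * lah_poly m (n - i))))"
      by (simp add: sum_distrib_left sum_distrib_right smult_sum_right algebra_simps)
    also have "\<dots> = (\<Sum>m\<le>n. smult (s ^ Suc m) (?x ^ Suc m * (\<Sum>i\<le>n. ?q i * lah_poly m (n - i))))"
      by (subst sum.swap) (simp only: sum_distrib_left smult_sum_right)
    also have "\<dots> = (\<Sum>m\<le>n. smult (real N) (smult (s ^ Suc m) (?x ^ Suc m * lah_poly (Suc m) N)))"
      by (intro sum.cong refl) (simp add: Suc lessThan_Suc_atMost mult.commute)
    also have "\<dots> = smult (real N) (\<Sum>m\<le>n. smult (s ^ Suc m) (?x ^ Suc m * lah_poly (Suc m) N))"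
      by (simp only: smult_sum_right)
    \<comment> \<open>The new term at \<open>m = 0\<close> contains \<open>lah_poly 0 N\<close>,
      which is 0 as \<open>N > 0\<close>.\<close>
    also have "(\<Sum>m\<le>n. smult (s ^ Suc m) (?x ^ Suc m * lah_poly (Suc m) N)) =
        (\<Sum>m\<le>N. smult (s ^ m) (?x ^ m * lah_poly m N))"
      unfolding Suc by (subst sum.atMost_Suc_shift) simp
    finally have "smult (1 / real N) (smult (real N) (lah_series s N)) =
       smult (1 / real N) (smult (real N) (\<Sum>m\<le>N. smult (s ^ m) (?x ^ m * lah_poly m N)))" by simp
    then show ?thesis using Suc by (simp only: smult_smult) simp
  qed
qed

section \<open>Eulerian polynomials and their coefficients\<close>

definition power_series :: "nat \<Rightarrow> real fps" where
  "power_series m = Abs_fps (\<lambda>i. if i = 0 then 0 else real i ^ m)"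

text \<open>For \<open>m \<ge> 1\<close> this is \<open>x\<close> times the classical Eulerian
  polynomial. For \<open>m = 0\<close>, where \<open>0 ^ 0 = 1\<close>, dropping the term
  \<open>i = 0\<close> from \<open>power_series\<close> makes it \<open>x\<close>.\<close>

definition eulerian_series :: "nat \<Rightarrow> real fps" where
  "eulerian_series m = (1 - fps_X) ^ Suc m * power_series m"

lemma eulerian_series_0: "eulerian_series 0 = fps_X"
proof (rule fps_ext)
  show "fps_nth (eulerian_series 0) n = fps_nth fps_X n" for n
    by (cases n) (auto simp: eulerian_series_def power_series_def algebra_simps)
qed

lemma power_series_Suc: "power_series (Suc m) = fps_X * fps_deriv (power_series m)"
proof (rule fps_ext)
  show "fps_nth (power_series (Suc m)) n = fps_nth (fps_X * fps_deriv (power_series m)) n" for n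
    by (cases n) (auto simp: power_series_def algebra_simps)
qed

text \<open>Since \<open>x d/dx\<close> maps \<open>power_series m\<close> to the next one, the
  product rule gives the recursion of the Eulerian polynomials.\<close>

lemma eulerian_series_Suc:
  "eulerian_series (Suc m) = fps_X * (1 - fps_X) * fps_deriv (eulerian_series m) +
     of_nat (Suc m) * fps_X * eulerian_series m"
proof -
  have "fps_deriv ((1 - fps_X) ^ Suc m) = - of_nat (Suc m) * (1 - fps_X :: real fps) ^ m"
    by (subst fps_deriv_power') (simp del: of_nat_Suc power_Suc)
  then have deriv: "fps_deriv (eulerian_series m) =
      (1 - fps_X) ^ Suc m * fps_deriv (power_series m) +
      - of_nat (Suc m) * (1 - fps_X) ^ m * power_series m"
    by (simp only: eulerian_series_def fps_deriv_mult)
  have alg: "Y ^ Suc (Suc m) * (x * p) =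
      x * Y * (Y ^ Suc m * p + - c * Y ^ m * q) + c * x * (Y ^ Suc m * q)" for x Y p q c :: "real fps"
    by (simp add: algebra_simps)
  show ?thesis
    unfolding deriv unfolding eulerian_series_def power_series_Suc by (rule alg)
qed

lemma eulerian_series_nth_0: "fps_nth (eulerian_series m) 0 = 0"
  by (simp add: eulerian_series_def power_series_def)

text \<open>The recurrence of the Eulerian numbers. The weight \<open>m + 1 - i\<close> can be
  negative, so signs need control of the support.\<close>

lemma eulerian_series_nth_Suc:
  "fps_nth (eulerian_series (Suc m)) (Suc i) =
     real (Suc i) * fps_nth (eulerian_series m) (Suc i) +
     (real m + 1 - real i) * fps_nth (eulerian_series m) i"
proof -
  let ?B = "eulerian_series m"
  have "eulerian_series (Suc m) = fps_X * (fps_deriv ?B - fps_X * fps_deriv ?B + fps_const (real (Suc m)) * ?B)"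
    by (simp only: eulerian_series_Suc fps_of_nat) (simp add: algebra_simps)
  then have "fps_nth (eulerian_series (Suc m)) (Suc i) =
      fps_nth (fps_deriv ?B - fps_X * fps_deriv ?B + fps_const (real (Suc m)) * ?B) i"
    by simp
  then show ?thesis
    by (cases i) (simp_all add: algebra_simps)
qed

lemma eulerian_series_nth_eq_0: "m + 2 \<le> i \<Longrightarrow> fps_nth (eulerian_series m) i = 0"
proof (induction m arbitrary: i)
  case 0
  then show ?case by (simp add: eulerian_series_0)
next
  case (Suc m)
  then obtain l where l: "i = Suc l" by (cases i) auto
  then show ?case using Suc by (simp add: eulerian_series_nth_Suc)
qed

text \<open>The weight \<open>m + 1 - l\<close> in the recurrence is negative only for
  \<open>l > m + 1\<close>, where the new coefficient is known to vanish.\<close>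

lemma eulerian_series_nth_nonneg: "fps_nth (eulerian_series m) i \<ge> 0"
proof (induction m arbitrary: i)
  case 0
  then show ?case by (simp add: eulerian_series_0)
next
  case (Suc m)
  show ?case
  proof (cases i)
    case 0
    then show ?thesis by (simp add: eulerian_series_nth_0)
  next
    case l: (Suc l)
    show ?thesis
    proof (cases "l \<le> m + 1")
      case True
      then show ?thesis unfolding l eulerian_series_nth_Suc
        by (intro add_nonneg_nonneg mult_nonneg_nonneg Suc.IH) auto
    next
      case False
      then show ?thesis using eulerian_series_nth_eq_0[of "Suc m" i] l by simp
    qed
  qed
qed

text \<open>The maximum accounts for \<open>m = 0\<close>, whose series is \<open>x\<close>. Old
  indices stay positive through the first summand of the recurrence; a new top index
  \<open>m + 1\<close> is positive through the second, which has weight 1 there.\<close>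

lemma eulerian_series_nth_pos:
  "1 \<le> i \<Longrightarrow> i \<le> max m 1 \<Longrightarrow> fps_nth (eulerian_series m) i > 0"
proof (induction m arbitrary: i)
  case 0
  then show ?case by (simp add: eulerian_series_0)
next
  case (Suc m)
  then obtain l where l: "i = Suc l" by (cases i) auto
  show ?case
  proof (cases "i \<le> max m 1")
    case True
    then have "fps_nth (eulerian_series m) i > 0" using Suc by auto
    then show ?thesis unfolding l eulerian_series_nth_Suc
      using Suc.prems l True by (intro add_pos_nonneg mult_nonneg_nonneg eulerian_series_nth_nonneg) auto
  next
    case False
    then have "l = m" "m \<ge> 1" using Suc.prems l by auto
    then have "fps_nth (eulerian_series m) l > 0" using Suc by auto
    then show ?thesis unfolding l eulerian_series_nth_Suc
      using \<open>l = m\<close> by (intro add_nonneg_pos mult_nonneg_nonneg eulerian_series_nth_nonneg) auto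
  qed
qed

section \<open>Counting lattice points of dilated hypersimplices\<close>

definition slice_words :: "nat \<Rightarrow> nat \<Rightarrow> nat \<Rightarrow> nat list set" where
  "slice_words N t s = {xs. set xs \<subseteq> {..t} \<and> length xs = N \<and> sum_list xs = s}"

lemma finite_slice_words: "finite (slice_words N t s)"
  by (rule finite_subset[OF _ finite_lists_length_eq[of "{..t}" N]]) (auto simp: slice_words_def)

lemma card_slice_words_fps:
  "real (card (slice_words N t s)) = fps_nth ((\<Sum>i\<le>t. fps_X ^ i) ^ N) s"
proof (induction N arbitrary: s)
  case 0
  have "slice_words 0 t s = (if s = 0 then {[]} else {})" by (auto simp: slice_words_def)
  then show ?case by simp
next
  case (Suc N)
  have "slice_words (Suc N) t s = (\<Union>i\<in>{..min t s}. (#) i ` slice_words N t (s - i))"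
    by (auto simp: slice_words_def length_Suc_conv image_iff)
  also have "card \<dots> = (\<Sum>i\<le>min t s. card ((#) i ` slice_words N t (s - i)))"
    by (rule card_UN_disjoint) (auto simp: finite_slice_words)
  also have "\<dots> = (\<Sum>i\<le>min t s. card (slice_words N t (s - i)))"
    by (intro sum.cong refl card_image) auto
  finally have "real (card (slice_words (Suc N) t s)) =
      (\<Sum>i\<le>min t s. fps_nth ((\<Sum>i\<le>t. fps_X ^ i) ^ N) (s - i))" by (simp add: Suc)
  also have "\<dots> = (\<Sum>i\<le>t. if s < i then 0 else fps_nth ((\<Sum>i\<le>t. fps_X ^ i) ^ N) (s - i))"
    by (rule sum.mono_neutral_cong_left) auto
  also have "\<dots> = fps_nth ((\<Sum>i\<le>t. fps_X ^ i) ^ Suc N) s"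
    by (simp add: sum_distrib_right fps_sum_nth fps_X_power_mult_nth)
  finally show ?case .
qed

text \<open>Inclusion-exclusion over letters exceeding \<open>t\<close>: the \<open>j\<close>-th
  term comes from expanding \<open>(1 - z^(t+1))^N\<close> against
  \<open>(1 - z)^(-N)\<close>.\<close>

lemma card_slice_words:
  assumes "N > 0"
  shows "real (card (slice_words N t s)) =
    (\<Sum>j\<le>N. if j * (t + 1) \<le> s then (-1) ^ j * real (N choose j) * real ((N - 1 + s - j * (t + 1)) choose (N - 1)) else 0)"
proof -
  let ?Y = "1 - fps_X :: real fps"
  have "1 - fps_X ^ Suc t = ?Y * (\<Sum>i<Suc t. fps_X ^ i)"
    by (rule one_diff_power_eq)
  then have "(1 - fps_X ^ Suc t) ^ N = ?Y ^ N * (\<Sum>i\<le>t. fps_X ^ i) ^ N"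
    by (simp only: power_mult_distrib lessThan_Suc_atMost)
  then have "inverse (?Y ^ N) * (1 - fps_X ^ Suc t) ^ N = (inverse (?Y ^ N) * ?Y ^ N) * (\<Sum>i\<le>t. fps_X ^ i) ^ N"
    by (simp add: mult.assoc)
  also have "inverse (?Y ^ N) * ?Y ^ N = 1"
    by (rule inverse_mult_eq_1) (simp add: fps_nth_power_0)
  also have "(1 - fps_X ^ Suc t) ^ N = (\<Sum>j\<le>N. fps_const ((-1) ^ j * real (N choose j)) * fps_X ^ (j * Suc t))"
  proof -
    have "(- (fps_X ^ Suc t) + 1 :: real fps) ^ N = (\<Sum>j\<le>N. of_nat (N choose j) * (- (fps_X ^ Suc t)) ^ j * 1 ^ (N - j))"
      by (rule binomial_ring)
    also have "\<dots> = (\<Sum>j\<le>N. fps_const ((-1) ^ j * real (N choose j)) * fps_X ^ (j * Suc t))"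
    proof (rule sum.cong[OF refl])
      fix j
      have "(- (fps_X ^ Suc t) :: real fps) ^ j = fps_const ((-1) ^ j) * fps_X ^ (j * Suc t)"
      proof -
        have "(- (fps_X ^ Suc t) :: real fps) ^ j = (-1) ^ j * (fps_X ^ Suc t) ^ j"
          by (rule power_minus)
        moreover have "(-1 :: real fps) ^ j = fps_const ((-1) ^ j)"
          by (metis fps_const_1_eq_1 fps_const_neg fps_const_power)
        moreover have "(fps_X ^ Suc t :: real fps) ^ j = fps_X ^ (j * Suc t)"
          by (simp only: power_mult[symmetric] mult.commute)
        ultimately show ?thesis by simp
      qed
      then show "of_nat (N choose j) * (- (fps_X ^ Suc t)) ^ j * 1 ^ (N - j) =
          fps_const ((-1) ^ j * real (N choose j)) * fps_X ^ (j * Suc t)"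
        by (simp add: fps_of_nat[symmetric] mult_ac flip: fps_const_mult)
    qed
    finally show ?thesis by simp
  qed
  finally have eq: "(\<Sum>i\<le>t. fps_X ^ i) ^ N =
      (\<Sum>j\<le>N. fps_const ((-1) ^ j * real (N choose j)) * (fps_X ^ (j * Suc t) * inverse (?Y ^ N)))"
    by (simp add: sum_distrib_left mult_ac)
  have inv: "inverse (?Y ^ N) = Abs_fps (\<lambda>k. real ((N + k - 1) choose k))"
    using one_minus_const_fps_X_neg_power'[of N "1::real"] assms by simp
  show ?thesis
    unfolding card_slice_words_fps eq inv
  proof (simp only: fps_sum_nth, rule sum.cong[OF refl])
    fix j
    have "N + k - 1 choose k = (N - 1 + k choose (N - 1))" for k
      using assms binomial_symmetric[of k "N - 1 + k"] by simp
    then show "fps_nth (fps_const ((-1) ^ j * real (N choose j)) * (fps_X ^ (j * Suc t) * Abs_fps (\<lambda>k. real ((N + k - 1) choose k)))) s =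
      (if j * (t + 1) \<le> s then (-1) ^ j * real (N choose j) * real ((N - 1 + s - j * (t + 1)) choose (N - 1)) else 0)"
      using assms by (auto simp: fps_X_power_mult_nth)
  qed
qed

lemma rising_of_nat: "s > 0 \<Longrightarrow> rising (real s) j = real ((s + j - 1) choose j)"
proof (induction j)
  case (Suc j)
  define n where "n = s + j - 1"
  have n: "s + j = Suc n" using Suc.prems by (simp add: n_def)
  have "real (Suc j) * rising (real s) (Suc j) = (real s + real j) * rising (real s) j"
    by (rule rising_Suc)
  also have "real s + real j = real (Suc n)" using n by (metis of_nat_add)
  also have "rising (real s) j = real (n choose j)" using Suc n_def by simp
  also have "real (Suc n) * real (n choose j) = real (Suc j) * real (Suc n choose Suc j)"
    unfolding of_nat_mult[symmetric] Suc_times_binomial_eq mult.commute[of _ "Suc j"] ..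
  finally have "rising (real s) (Suc j) = real (Suc n choose Suc j)"
    by (simp only: mult_cancel_left of_nat_eq_0_iff nat.distinct) simp
  then show ?case using n by simp
qed simp

lemma rising_minus: "rising (- real s) j = (-1) ^ j * real (s choose j)"
proof -
  have "real (s choose j) = real s gchoose j" by (rule binomial_gbinomial)
  also have "\<dots> = (-1) ^ j * rising (- real s) j"
    by (simp add: gbinomial_pochhammer rising_def)
  finally show ?thesis by (simp add: power_mult_distrib[symmetric] mult.assoc[symmetric])
qed

text \<open>For \<open>j \<le> s\<close> both sides agree once written in factorials. With
  \<open>s = (k - j) * t\<close> the right side is \<open>s\<close> times the \<open>j\<close>-th
  term of \<open>card_slice_words\<close> for the slice \<open>k * t\<close>.\<close>

lemma coeff_lah_series_of_nat:
  assumes "s > 0" "N > 0" "j \<le> N"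
  shows "real N * coeff (lah_series (real s) N) j =
    real s * (if j \<le> s then (-1) ^ j * real (N choose j) * real ((N - 1 + s - j) choose (N - 1)) else 0)"
proof (cases "j \<le> s")
  case False
  then show ?thesis using assms by (simp add: coeff_lah_series rising_minus)
next
  case True
  have 1: "real (s choose j) = fact s / (fact j * fact (s - j))"
    using True by (rule binomial_fact)
  have 2: "real (N - 1 + s - j choose (N - j)) = fact (N - 1 + s - j) / (fact (N - j) * fact (s - 1))"
    using assms by (subst binomial_fact) auto
  have 3: "real (N choose j) = fact N / (fact j * fact (N - j))"
    using assms by (intro binomial_fact)
  have 4: "real ((N - 1 + s - j) choose (N - 1)) = fact (N - 1 + s - j) / (fact (N - 1) * fact (s - j))"
    using assms True by (subst binomial_fact) auto
  have 5: "fact N = real N * fact (N - 1)" "fact s = real s * fact (s - 1)"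
    using assms by (simp_all add: fact_reduce)
  have 6: "s + (N - j) - 1 = N - 1 + s - j" using assms by simp
  show ?thesis
    using assms True unfolding coeff_lah_series[OF assms(3)] rising_minus rising_of_nat[OF assms(1)] 6 1 2 3 4 5
    by (simp add: field_simps)
qed

text \<open>Collecting the alternating sum by powers of \<open>t\<close> turns each coefficient into
  one of a product of two series with nonnegative coefficients, \<open>lah_poly (Suc m) N\<close>
  and \<open>eulerian_series m\<close>, so the signs disappear.\<close>

lemma exists_slice_poly:
  assumes "1 \<le> k" "k < N"
  shows "\<exists>u. (\<forall>t>0. poly u (real t) = real (card (slice_words N t (k * t)))) \<and>
    degree u \<le> N - 1 \<and> (\<forall>m\<le>N - 1. coeff u m > 0)"
proof -
  let ?x = "1 - monom 1 1 :: real poly"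
  \<comment> \<open>\<open>h m j\<close> is the factor of \<open>s^(m+1)\<close> in the coefficient
    of \<open>x^j\<close> of \<open>lah_series s N\<close>. The shift by one reflects the division
    by \<open>s\<close>, and \<open>c m\<close> becomes the coefficient of
    \<open>t^m\<close>.\<close>
  define h where "h = (\<lambda>m j. coeff (?x ^ Suc m * lah_poly (Suc m) N) j)"
  define c where "c = (\<lambda>m. real N * (\<Sum>j<k. h m j * real (k - j) ^ m))"
  define u where "u = (\<Sum>m<N. monom (c m) m)"
  have coeff_u: "coeff u m = (if m < N then c m else 0)" for m
    by (auto simp: u_def coeff_sum)
  have "poly u (real t) = real (card (slice_words N t (k * t)))" if t: "t > 0" for t
  proof -
    have N: "N > 0" using assms by simp
    let ?g = "\<lambda>j. (-1) ^ j * real (N choose j) * real ((N - 1 + k * t - j * (t + 1)) choose (N - 1))"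
    have "real (card (slice_words N t (k * t))) = (\<Sum>j\<le>N. if j * (t + 1) \<le> k * t then ?g j else 0)"
      by (rule card_slice_words[OF N])
    also have "\<dots> = (\<Sum>j<k. real N * (\<Sum>m<N. real ((k - j) * t) ^ m * h m j))"
    proof (rule sum.mono_neutral_cong_right)
      show "{..<k} \<subseteq> {..N}" using assms by auto
      show "\<forall>j\<in>{..N} - {..<k}. (if j * (t + 1) \<le> k * t then ?g j else 0) = 0"
      proof
        fix j assume "j \<in> {..N} - {..<k}"
        then have "k \<le> j" by simp
        then have "k * t < j * (t + 1)"
          using assms by (intro le_less_trans[OF mult_right_mono[of k j t]]) auto
        then show "(if j * (t + 1) \<le> k * t then ?g j else 0) = 0" by simp
      qed
      fix j assume "j \<in> {..<k}"
      then have j: "j < k" by simp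
      define s where "s = (k - j) * t"
      have s: "s > 0" using j t by (simp add: s_def)
      have kt: "k * t = s + j * t"
        using j unfolding s_def add_mult_distrib[symmetric] by simp
      have "coeff (lah_series (real s) N) j = (\<Sum>m\<le>N. real s ^ m * coeff (?x ^ m * lah_poly m N) j)"
        by (simp add: lah_series_expansion coeff_sum)
      \<comment> \<open>The term \<open>m = 0\<close> vanishes since \<open>N > 0\<close>, so a
        factor \<open>s\<close> comes out and can be cancelled below.\<close>
      also have "\<dots> = real s * (\<Sum>m<N. real s ^ m * h m j)"
      proof -
        obtain n where n: "N = Suc n" using N by (cases N) auto
        show ?thesis unfolding n
          by (subst sum.atMost_Suc_shift) (simp add: h_def n sum_distrib_left mult_ac lessThan_Suc_atMost)
      qed
      finally have "real s * (real N * (\<Sum>m<N. real s ^ m * h m j)) = real N * coeff (lah_series (real s) N) j"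
        by simp
      also have "\<dots> = real s * (if j \<le> s then (-1) ^ j * real (N choose j) * real ((N - 1 + s - j) choose (N - 1)) else 0)"
        using s N j assms by (intro coeff_lah_series_of_nat) auto
      finally have "real N * (\<Sum>m<N. real s ^ m * h m j) =
          (if j \<le> s then (-1) ^ j * real (N choose j) * real ((N - 1 + s - j) choose (N - 1)) else 0)"
        using s by simp
      moreover have "j * (t + 1) \<le> k * t \<longleftrightarrow> j \<le> s" "N - 1 + k * t - j * (t + 1) = N - 1 + s - j"
        by (auto simp: kt)
      ultimately show "(if j * (t + 1) \<le> k * t then ?g j else 0) = real N * (\<Sum>m<N. real ((k - j) * t) ^ m * h m j)"
        by (simp add: s_def)
    qed auto
    also have "\<dots> = (\<Sum>m<N. \<Sum>j<k. real N * (real ((k - j) * t) ^ m * h m j))"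
      by (subst sum.swap) (simp add: sum_distrib_left)
    also have "\<dots> = poly u (real t)"
      by (simp add: u_def poly_sum poly_monom c_def sum_distrib_left sum_distrib_right power_mult_distrib mult_ac)
    finally show ?thesis by simp
  qed
  moreover have "degree u \<le> N - 1"
    by (rule degree_le) (use assms in \<open>auto simp: coeff_u\<close>)
  moreover have "coeff u m > 0" if "m \<le> N - 1" for m
  proof -
    let ?L = "fps_of_poly (lah_poly (Suc m) N)" and ?B = "eulerian_series m"
    have m: "m < N" using that assms by simp
    have "fps_of_poly ?x = 1 - fps_X"
      by (simp only: fps_of_poly_diff fps_of_poly_1 fps_of_poly_monom' power_one_right)
    \<comment> \<open>The factor \<open>(1 - x)^(m+1)\<close> hidden in \<open>h\<close> is moved
      over to \<open>power_series m\<close>, which it turns into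
      \<open>eulerian_series m\<close>.\<close>
    then have "fps_of_poly (?x ^ Suc m * lah_poly (Suc m) N) * power_series m = ?L * ?B"
      by (simp only: fps_of_poly_mult fps_of_poly_power eulerian_series_def mult_ac)
    then have "fps_nth (?L * ?B) k = (\<Sum>j\<le>k. h m j * fps_nth (power_series m) (k - j))"
      by (metis (no_types, lifting) fps_mult_nth atLeast0AtMost fps_of_poly_nth h_def sum.cong)
    \<comment> \<open>The term \<open>j = k\<close> drops out because \<open>power_series\<close>
      has no constant term, even for \<open>m = 0\<close>.\<close>
    also have "\<dots> = (\<Sum>j<k. h m j * real (k - j) ^ m)"
      by (rule sum.mono_neutral_cong_right) (auto simp: power_series_def)
    finally have "c m = real N * fps_nth (?L * ?B) k" by (simp add: c_def)
    moreover have "fps_nth (?L * ?B) k > 0"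
    proof -
      \<comment> \<open>One positive product suffices. \<open>i\<close> is the largest index up to
        \<open>k\<close> in the positive range of the Eulerian coefficients; because
        \<open>k < N\<close>, the complementary index \<open>k - i\<close> falls in the range of
        \<open>coeff_lah_poly_pos\<close>.\<close>
      define i where "i = min k (max m 1)"
      have i: "i \<le> k" "1 \<le> i" "i \<le> max m 1" "k - i \<le> N - Suc m" using assms m by (auto simp: i_def)
      have "fps_nth (?L * ?B) k = (\<Sum>j\<le>k. coeff (lah_poly (Suc m) N) j * fps_nth ?B (k - j))"
        by (simp add: fps_mult_nth atLeast0AtMost)
      also have "\<dots> > 0"
      proof (rule sum_pos2[of _ "k - i"])
        show "coeff (lah_poly (Suc m) N) (k - i) * fps_nth ?B (k - (k - i)) > 0"
          using i m by (intro mult_pos_pos coeff_lah_poly_pos eulerian_series_nth_pos) auto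
      qed (auto simp del: lah_poly.simps
          intro!: mult_nonneg_nonneg coeff_lah_poly_nonneg eulerian_series_nth_nonneg)
      finally show ?thesis .
    qed
    ultimately show ?thesis using m by (simp add: coeff_u)
  qed
  ultimately show ?thesis by blast
qed

section \<open>Catalan matroids\<close>

lemma concat_replicate_nth:
  assumes "p < n * length w"
  shows "concat (replicate n w) ! p = w ! (p mod length w)"
  using assms
proof (induction n arbitrary: p)
  case (Suc n)
  show ?case
  proof (cases "p < length w")
    case False
    then have "concat (replicate n w) ! (p - length w) = w ! ((p - length w) mod length w)"
      using Suc.prems by (intro Suc.IH) auto
    then show ?thesis using False by (simp add: nth_append le_mod_geq)
  qed (simp add: nth_append)
qed simp

lemma catalan_set_eq:
  "catalan_set a b n = {i \<in> {1..n * (a + b)}. a \<le> (i - 1) mod (a + b)}"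
proof -
  have "catalan_word a b n ! (i - 1) = 1 \<longleftrightarrow> a \<le> (i - 1) mod (a + b)"
    if "i \<in> {1..n * (a + b)}" for i
  proof -
    have "i - 1 < n * (a + b)" using that by auto
    moreover have "(i - 1) mod (a + b) < a + b" using that by (intro mod_less_divisor) (cases "a + b = 0", auto)
    ultimately show ?thesis
      using concat_replicate_nth[of "i - 1" n "replicate a 0 @ replicate b (1::nat)"]
      by (auto simp: catalan_word_def nth_append)
  qed
  then show ?thesis by (auto simp: catalan_set_def)
qed

text \<open>Each complete block contributes \<open>b\<close>. In a partial block the truncated
  subtraction discounts the first \<open>a\<close> positions, which carry zeros.\<close>

lemma card_catalan_set_initial:
  assumes "b > 0" "k \<le> n * (a + b)"
  shows "card (catalan_set a b n \<inter> {..k}) = k div (a + b) * b + (k mod (a + b) - a)"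
  using assms(2)
proof (induction k)
  case 0
  have "catalan_set a b n \<inter> {..0} = {}" by (auto simp: catalan_set_eq)
  then show ?case by simp
next
  case (Suc k)
  let ?S = "catalan_set a b n"
  have mem: "Suc k \<in> ?S \<longleftrightarrow> a \<le> k mod (a + b)" using Suc.prems by (auto simp: catalan_set_eq)
  have "?S \<inter> {..Suc k} = (if Suc k \<in> ?S then insert (Suc k) (?S \<inter> {..k}) else ?S \<inter> {..k})"
    by (auto simp: le_Suc_eq)
  then have "card (?S \<inter> {..Suc k}) = card (?S \<inter> {..k}) + (if a \<le> k mod (a + b) then 1 else 0)"
    using mem by simp
  also have "card (?S \<inter> {..k}) = k div (a + b) * b + (k mod (a + b) - a)"
    using Suc by simp
  finally have eq: "card (?S \<inter> {..Suc k}) =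
      k div (a + b) * b + (k mod (a + b) - a) + (if a \<le> k mod (a + b) then 1 else 0)" .
  show ?case
  proof (cases "Suc (k mod (a + b)) = a + b")
    case True
    then have "Suc k mod (a + b) = 0" "Suc k div (a + b) = Suc (k div (a + b))"
      by (simp_all add: mod_Suc div_Suc)
    moreover have "k mod (a + b) = a + b - 1" using True by simp
    ultimately show ?thesis unfolding eq using assms(1) by simp
  next
    case False
    then have "Suc k mod (a + b) = Suc (k mod (a + b))" "Suc k div (a + b) = k div (a + b)"
      by (simp_all add: mod_Suc div_Suc)
    then show ?thesis unfolding eq by (simp add: Suc_diff_le)
  qed
qed

lemma card_catalan_set: "b > 0 \<Longrightarrow> card (catalan_set a b n) = n * b"
proof -
  assume b: "b > 0"
  have "catalan_set a b n \<inter> {..n * (a + b)} = catalan_set a b n" by (auto simp: catalan_set_def)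
  then show ?thesis using card_catalan_set_initial[OF b, of "n * (a + b)" n a] b by simp
qed

section \<open>Words cut into blocks, as bridges and excursions\<close>

lemma bij_betw_concat_blocks:
  "bij_betw concat {xss. set xss \<subseteq> {ys. set ys \<subseteq> A \<and> length ys = m} \<and> length xss = n}
     {xs. set xs \<subseteq> A \<and> length xs = n * m}"
  unfolding bij_betw_def
proof
  show "inj_on concat {xss. set xss \<subseteq> {ys. set ys \<subseteq> A \<and> length ys = m} \<and> length xss = n}"
  proof (rule inj_onI)
    fix xss yss
    assume x: "xss \<in> {xss. set xss \<subseteq> {ys. set ys \<subseteq> A \<and> length ys = m} \<and> length xss = n}"
      and y: "yss \<in> {xss. set xss \<subseteq> {ys. set ys \<subseteq> A \<and> length ys = m} \<and> length xss = n}"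
      and eq: "concat xss = concat yss"
    show "xss = yss"
    proof (rule concat_injective[OF eq])
      show "length xss = length yss" using x y by simp
      have "length ys = m" if "ys \<in> set xss \<union> set yss" for ys using that x y by blast
      then show "\<forall>(xs, ys)\<in>set (zip xss yss). length xs = length ys"
        using set_zip_leftD[of _ _ xss yss] set_zip_rightD[of _ _ xss yss] by (metis (mono_tags, lifting) UnCI case_prodI2)
    qed
  qed
  show "concat ` {xss. set xss \<subseteq> {ys. set ys \<subseteq> A \<and> length ys = m} \<and> length xss = n} =
    {xs. set xs \<subseteq> A \<and> length xs = n * m}"
  proof (induction n)
    case 0
    then show ?case by auto
  next
    case (Suc n)
    show ?case
    proof (intro equalityI subsetI)
      fix xs assume "xs \<in> concat ` {xss. set xss \<subseteq> {ys. set ys \<subseteq> A \<and> length ys = m} \<and> length xss = Suc n}"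
      then obtain ys yss where *: "xs = ys @ concat yss" "set ys \<subseteq> A" "length ys = m"
        "set yss \<subseteq> {ys. set ys \<subseteq> A \<and> length ys = m}" "length yss = n"
        by (auto simp: length_Suc_conv)
      then have "concat yss \<in> {xs. set xs \<subseteq> A \<and> length xs = n * m}" using Suc.IH by blast
      then show "xs \<in> {xs. set xs \<subseteq> A \<and> length xs = Suc n * m}" using * by simp
    next
      fix xs assume xs: "xs \<in> {xs. set xs \<subseteq> A \<and> length xs = Suc n * m}"
      then have "drop m xs \<in> {xs. set xs \<subseteq> A \<and> length xs = n * m}"
        using set_drop_subset[of m xs] by auto
      then have "drop m xs \<in> concat ` {xss. set xss \<subseteq> {ys. set ys \<subseteq> A \<and> length ys = m} \<and> length xss = n}"
        unfolding Suc.IH .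
      then obtain yss where yss: "drop m xs = concat yss"
        "set yss \<subseteq> {ys. set ys \<subseteq> A \<and> length ys = m}" "length yss = n"
        by blast
      have "xs = concat (take m xs # yss)" using yss(1) by (metis append_take_drop_id concat.simps(2))
      moreover have "set (take m xs # yss) \<subseteq> {ys. set ys \<subseteq> A \<and> length ys = m}"
        using xs yss set_take_subset[of m xs] by auto
      ultimately show "xs \<in> concat ` {xss. set xss \<subseteq> {ys. set ys \<subseteq> A \<and> length ys = m} \<and> length xss = Suc n}"
        using yss(3) by (intro image_eqI[of _ _ "take m xs # yss"]) auto
    qed
  qed
qed

lemma take_concat_blocks:
  "\<forall>ys\<in>set xss. length ys = m \<Longrightarrow> take (j * m) (concat xss) = concat (take j xss)"
proof (induction xss arbitrary: j)
  case (Cons ys xss)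
  then show ?case by (cases j) auto
qed simp

lemma image_filter_image: "f ` {x \<in> X. P (f x)} = {y \<in> f ` X. P y}"
  by blast

definition blocks :: "nat \<Rightarrow> nat \<Rightarrow> nat list set" where
  "blocks m t = {ys. set ys \<subseteq> {..t} \<and> length ys = m}"

definition excess :: "nat \<Rightarrow> nat list \<Rightarrow> int" where
  "excess c ys = int (sum_list ys) - int c"

lemma finite_blocks: "finite (blocks m t)"
  unfolding blocks_def by (rule finite_lists_length_eq) simp

lemma sum_list_excess:
  "sum_list (map (excess c) xss) = int (sum_list (concat xss)) - int (length xss * c)"
  by (induction xss) (auto simp: excess_def algebra_simps)

lemma card_bridges_blocks:
  "card (bridges (excess (t * b)) (blocks m t) k) = card (slice_words (k * m) t (k * b * t))"
proof -
  let ?X = "{xss. set xss \<subseteq> {ys. set ys \<subseteq> {..t} \<and> length ys = m} \<and> length xss = k}"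
  have "bij_betw concat (bridges (excess (t * b)) (blocks m t) k) (slice_words (k * m) t (k * b * t))"
  proof (rule bij_betw_subset[OF bij_betw_concat_blocks[of "{..t}" m k]])
    have "int (sum_list (concat xss)) - int (k * (t * b)) = 0 \<longleftrightarrow> sum_list (concat xss) = k * b * t" for xss
      by (simp only: right_minus_eq of_nat_eq_iff mult_ac)
    then have br: "bridges (excess (t * b)) (blocks m t) k = {xss \<in> ?X. sum_list (concat xss) = k * b * t}"
      by (auto simp: bridges_def blocks_def sum_list_excess)
    then show "bridges (excess (t * b)) (blocks m t) k \<subseteq> ?X" by blast
    have "concat ` ?X = {xs. set xs \<subseteq> {..t} \<and> length xs = k * m}"
      using bij_betw_concat_blocks by (rule bij_betw_imp_surj_on)
    then have sl: "slice_words (k * m) t (k * b * t) = {xs \<in> concat ` ?X. sum_list xs = k * b * t}"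
      by (auto simp: slice_words_def)
    show "concat ` bridges (excess (t * b)) (blocks m t) k = slice_words (k * m) t (k * b * t)"
      unfolding br by (rule trans[OF image_filter_image sl[symmetric]])
  qed
  then show ?thesis by (rule bij_betw_same_card)
qed

lemma sum_list_le_length: "set xs \<subseteq> {..t} \<Longrightarrow> sum_list xs \<le> length xs * (t :: nat)"
  by (induction xs) auto

text \<open>Only block boundaries matter. Along the first \<open>a\<close> letters of a block the
  bound is constant while prefix sums do not decrease. Along the last \<open>b\<close> it grows by
  \<open>t\<close> per letter and the prefix sum by at most \<open>t\<close>, so the bound at the
  end of the block implies the earlier ones.\<close>

lemma schubert_words_catalan:
  assumes b: "b > 0"
  shows "schubert_words (n * (a + b)) (catalan_set a b n) t =
    {xs. set xs \<subseteq> {..t} \<and> length xs = n * (a + b) \<and> sum_list xs = n * b * t \<and>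
      (\<forall>j\<le>n. j * b * t \<le> sum_list (take (j * (a + b)) xs))}"
proof -
  let ?m = "a + b"
  let ?S = "catalan_set a b n"
  have "(\<forall>k\<le>n * ?m. t * card (?S \<inter> {..k}) \<le> sum_list (take k xs)) \<longleftrightarrow>
      (\<forall>j\<le>n. j * b * t \<le> sum_list (take (j * ?m) xs))" (is "?L \<longleftrightarrow> ?R")
    if sub: "set xs \<subseteq> {..t}" and len: "length xs = n * ?m" for xs
  proof
    assume L: ?L
    show ?R
    proof (intro allI impI)
      fix j assume "j \<le> n"
      then have "j * ?m \<le> n * ?m" by (rule mult_right_mono) simp
      then have "t * card (?S \<inter> {..j * ?m}) \<le> sum_list (take (j * ?m) xs)"
        "card (?S \<inter> {..j * ?m}) = j * ?m div ?m * b + (j * ?m mod ?m - a)"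
        using L card_catalan_set_initial[OF b] by blast+
      then show "j * b * t \<le> sum_list (take (j * ?m) xs)" using b by (simp add: mult_ac)
    qed
  next
    assume R: ?R
    show ?L
    proof (intro allI impI)
      fix k assume k: "k \<le> n * ?m"
      define j c where "j = k div ?m" and "c = k mod ?m"
      have kjc: "k = j * ?m + c" unfolding j_def c_def by (rule div_mult_mod_eq[symmetric])
      have c: "c < ?m" using b by (simp add: c_def)
      have card: "card (?S \<inter> {..k}) = j * b + (c - a)"
        using card_catalan_set_initial[OF b k] by (simp add: j_def c_def)
      have jn: "j \<le> n"
        using k b by (metis add_gr_0 div_le_mono j_def nonzero_mult_div_cancel_right not_less_zero)
      show "t * card (?S \<inter> {..k}) \<le> sum_list (take k xs)"
      proof (cases "c \<le> a")
        case True
        have "take k xs = take (j * ?m) xs @ take c (drop (j * ?m) xs)" unfolding kjc by (rule take_add)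
        then have "sum_list (take (j * ?m) xs) \<le> sum_list (take k xs)" by simp
        moreover have "j * b * t \<le> sum_list (take (j * ?m) xs)" using R jn by blast
        ultimately show ?thesis using card True by (simp add: mult_ac)
      next
        case False
        have "j * ?m < n * ?m" using False k kjc by linarith
        then have "Suc j \<le> n" by (simp add: Suc_le_eq)
        then have 1: "Suc j * b * t \<le> sum_list (take (Suc j * ?m) xs)" using R by blast
        have e: "Suc j * ?m = k + (?m - c)" using kjc c by simp
        let ?r = "take (?m - c) (drop k xs)"
        have "take (Suc j * ?m) xs = take k xs @ ?r" unfolding e by (rule take_add)
        moreover have "sum_list ?r \<le> (?m - c) * t"
        proof -
          have "set ?r \<subseteq> {..t}" using sub by (meson order_trans set_drop_subset set_take_subset)
          then have "sum_list ?r \<le> length ?r * t" by (rule sum_list_le_length)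
          also have "\<dots> \<le> (?m - c) * t" by (rule mult_right_mono) auto
          finally show ?thesis .
        qed
        ultimately have "Suc j * b * t \<le> sum_list (take k xs) + (?m - c) * t" using 1 by simp
        moreover have "Suc j * b = (j * b + (c - a)) + (?m - c)" using False c by simp
        then have "Suc j * b * t = (j * b + (c - a)) * t + (?m - c) * t" by (simp only: add_mult_distrib)
        ultimately show ?thesis unfolding card by (simp add: mult.commute)
      qed
    qed
  qed
  then show ?thesis
    by (auto simp: schubert_words_def card_catalan_set[OF b] mult_ac)
qed

text \<open>The inequalities left by \<open>schubert_words_catalan\<close> say exactly that the walk
  of block excesses stays nonnegative.\<close>

lemma card_excursions_blocks:
  assumes b: "b > 0"
  shows "card (excursions (excess (t * b)) (blocks (a + b) t) n) =
    card (schubert_words (n * (a + b)) (catalan_set a b n) t)"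
proof -
  let ?m = "a + b"
  let ?X = "{xss. set xss \<subseteq> {ys. set ys \<subseteq> {..t} \<and> length ys = ?m} \<and> length xss = n}"
  let ?C = "\<lambda>xs. sum_list xs = n * b * t \<and> (\<forall>j\<le>n. j * b * t \<le> sum_list (take (j * ?m) xs))"
  have "bij_betw concat (excursions (excess (t * b)) (blocks ?m t) n)
      (schubert_words (n * ?m) (catalan_set a b n) t)"
  proof (rule bij_betw_subset[OF bij_betw_concat_blocks[of "{..t}" ?m n]])
    have eq: "int (sum_list (concat xss)) - int (n * (t * b)) = 0 \<longleftrightarrow> sum_list (concat xss) = n * b * t" for xss
      by (simp only: right_minus_eq of_nat_eq_iff mult_ac)
    have pre: "(\<forall>p q. xss = p @ q \<longrightarrow> 0 \<le> sum_list (map (excess (t * b)) p)) \<longleftrightarrow>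
        (\<forall>j\<le>n. j * b * t \<le> sum_list (take (j * ?m) (concat xss)))" if X: "xss \<in> ?X" for xss
    proof -
      have "(\<forall>p q. xss = p @ q \<longrightarrow> 0 \<le> sum_list (map (excess (t * b)) p)) \<longleftrightarrow>
          (\<forall>j\<le>n. 0 \<le> sum_list (map (excess (t * b)) (take j xss)))"
      proof (intro iffI allI impI)
        fix j assume "\<forall>p q. xss = p @ q \<longrightarrow> 0 \<le> sum_list (map (excess (t * b)) p)"
        then show "0 \<le> sum_list (map (excess (t * b)) (take j xss))"
          by (metis append_take_drop_id)
      next
        fix p q assume *: "\<forall>j\<le>n. 0 \<le> sum_list (map (excess (t * b)) (take j xss))" "xss = p @ q"
        then have "length p \<le> n" "take (length p) xss = p" using X by auto
        then show "0 \<le> sum_list (map (excess (t * b)) p)" using * by metis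
      qed
      also have "\<dots> \<longleftrightarrow> (\<forall>j\<le>n. j * b * t \<le> sum_list (take (j * ?m) (concat xss)))"
      proof (intro all_cong1 imp_cong refl)
        fix j assume j: "j \<le> n"
        have "sum_list (map (excess (t * b)) (take j xss)) =
            int (sum_list (take (j * ?m) (concat xss))) - int (j * (t * b))"
        proof -
          have "\<forall>ys\<in>set xss. length ys = ?m" and len: "length xss = n" using X by auto
          from take_concat_blocks[OF this(1), of j] show ?thesis
            using len j by (simp add: sum_list_excess)
        qed
        then show "0 \<le> sum_list (map (excess (t * b)) (take j xss)) \<longleftrightarrow>
            j * b * t \<le> sum_list (take (j * ?m) (concat xss))"
          by (simp only: diff_ge_0_iff_ge of_nat_le_iff mult_ac)
      qed
      finally show ?thesis .
    qed
    have br: "bridges (excess (t * b)) (blocks ?m t) n = {xss \<in> ?X. sum_list (concat xss) = n * b * t}"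
      using eq by (auto simp: bridges_def blocks_def sum_list_excess)
    have cong: "{x \<in> B. Q x} = {x \<in> X. R x \<and> S x}"
      if "B = {x \<in> X. R x}" "\<And>x. x \<in> X \<Longrightarrow> Q x \<longleftrightarrow> S x"
      for B X :: "nat list list set" and Q R S using that by auto
    have ex: "excursions (excess (t * b)) (blocks ?m t) n = {xss \<in> ?X. ?C (concat xss)}"
      unfolding excursions_def by (rule cong[OF br pre])
    then show "excursions (excess (t * b)) (blocks ?m t) n \<subseteq> ?X" by blast
    have "concat ` ?X = {xs. set xs \<subseteq> {..t} \<and> length xs = n * ?m}"
      using bij_betw_concat_blocks by (rule bij_betw_imp_surj_on)
    then have sw: "schubert_words (n * ?m) (catalan_set a b n) t = {xs \<in> concat ` ?X. ?C xs}"
      unfolding schubert_words_catalan[OF b] by simp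
    show "concat ` excursions (excess (t * b)) (blocks ?m t) n = schubert_words (n * ?m) (catalan_set a b n) t"
      unfolding ex by (rule trans[OF image_filter_image sw[symmetric]])
  qed
  then show ?thesis by (rule bij_betw_same_card)
qed

section \<open>Positivity passes from bridges to excursions\<close>

lemma coeff_mult_nonneg:
  fixes p q :: "real poly"
  assumes "\<And>i. coeff p i \<ge> 0" "\<And>i. coeff q i \<ge> 0"
  shows "coeff (p * q) i \<ge> 0"
  unfolding coeff_mult using assms by (intro sum_nonneg mult_nonneg_nonneg)

text \<open>Strong induction along \<open>card_excursions_rec\<close>. All terms have nonnegative
  coefficients, and the term \<open>k = n\<close>, the polynomial of a hypersimplex, alone makes
  every coefficient up to the degree bound positive. For \<open>n = 0\<close> the polynomial is 1
  and only nonnegativity is claimed.\<close>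

lemma exists_excursion_poly:
  assumes a: "a > 0" and b: "b > 0"
  shows "\<exists>p. (\<forall>t>0. poly p (real t) = real (card (excursions (excess (t * b)) (blocks (a + b) t) n))) \<and>
    degree p \<le> n * (a + b) - 1 \<and> (\<forall>i. coeff p i \<ge> 0) \<and> (n > 0 \<longrightarrow> (\<forall>i\<le>n * (a + b) - 1. coeff p i > 0))"
proof (induction n rule: less_induct)
  case (less n)
  let ?m = "a + b"
  let ?A = "\<lambda>n t. real (card (excursions (excess (t * b)) (blocks ?m t) n))"
  let ?B = "\<lambda>k t. real (card (slice_words (k * ?m) t (k * b * t)))"
  have exc0: "excursions v S 0 = {[]}" for v :: "nat list \<Rightarrow> int" and S
    by (auto simp: excursions_def bridges_def)
  show ?case
  proof (cases "n = 0")
    case True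
    then show ?thesis by (intro exI[of _ 1]) (simp add: exc0)
  next
    case n: False
    define P where "P = (\<lambda>p l. (\<forall>t>0. poly p (real t) = ?A l t) \<and> degree p \<le> l * ?m - 1 \<and>
      (\<forall>i. coeff p i \<ge> 0))"
    have "\<forall>l. \<exists>p. l < n \<longrightarrow> P p l" using less.IH unfolding P_def by blast
    then obtain p where p: "\<And>l. l < n \<Longrightarrow> P (p l) l" by metis
    define U where "U = (\<lambda>u k. (\<forall>t>0. poly u (real t) = ?B k t) \<and> degree u \<le> k * ?m - 1 \<and>
      (\<forall>i\<le>k * ?m - 1. coeff u i > 0))"
    have "\<forall>k. \<exists>u. 1 \<le> k \<longrightarrow> U u k"
    proof
      fix k
      show "\<exists>u. 1 \<le> k \<longrightarrow> U u k"
        using exists_slice_poly[of "k * b" "k * ?m"] a b unfolding U_def by (cases "1 \<le> k") auto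
    qed
    then obtain u where u: "\<And>k. 1 \<le> k \<Longrightarrow> U (u k) k" by metis
    have u_nonneg: "coeff (u k) i \<ge> 0" if "1 \<le> k" for k i
    proof (cases "i \<le> k * ?m - 1")
      case True
      then show ?thesis using u[OF that] by (auto simp: U_def intro: less_imp_le)
    next
      case False
      then have "degree (u k) < i" using u[OF that] by (auto simp: U_def)
      then show ?thesis by (simp add: coeff_eq_0)
    qed
    \<comment> \<open>For \<open>k = n\<close> the excursion factor counts only the empty walk, so
      \<open>u n\<close> stands without a factor and its positive coefficients are available
      directly.\<close>
    define f where "f = (\<lambda>k. if k = n then u n else p (n - k) * u k)"
    define q where "q = smult (1 / real n) (\<Sum>k=1..n. f k)"
    have "poly q (real t) = ?A n t" if t: "t > 0" for t
    proof -
      have "real n * ?A n t = (\<Sum>k=1..n. ?A (n - k) t * ?B k t)"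
        using card_excursions_rec[OF finite_blocks, of n "excess (t * b)" ?m t]
        by (simp add: card_bridges_blocks flip: of_nat_mult of_nat_sum)
      also have "\<dots> = (\<Sum>k=1..n. poly (f k) (real t))"
      proof (rule sum.cong[OF refl])
        fix k assume k: "k \<in> {1..n}"
        have "poly (u k) (real t) = ?B k t" using u[of k] k t by (auto simp: U_def)
        moreover have "poly (p (n - k)) (real t) = ?A (n - k) t" if "k \<noteq> n"
          using p[of "n - k"] k t that by (auto simp: P_def)
        ultimately show "?A (n - k) t * ?B k t = poly (f k) (real t)"
          by (auto simp: f_def exc0)
      qed
      finally show ?thesis using n by (simp add: q_def poly_sum field_simps)
    qed
    moreover have deg: "degree (f k) \<le> n * ?m - 1" if k: "k \<in> {1..n}" for k
    proof (cases "k = n")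
      case True
      then show ?thesis using u[of n] n by (auto simp: f_def U_def)
    next
      case False
      have "degree (f k) \<le> degree (p (n - k)) + degree (u k)"
        using False by (simp add: f_def degree_mult_le)
      also have "\<dots> \<le> ((n - k) * ?m - 1) + (k * ?m - 1)"
        using p[of "n - k"] u[of k] k False by (intro add_mono) (auto simp: P_def U_def)
      also have "\<dots> \<le> ((n - k) * ?m + k * ?m) - 1" by simp
      also have "(n - k) * ?m + k * ?m = n * ?m"
        unfolding add_mult_distrib[symmetric] using k by simp
      finally show ?thesis .
    qed
    moreover have "degree q \<le> n * ?m - 1"
      unfolding q_def by (rule order_trans[OF degree_smult_le]) (intro degree_sum_le deg, auto)
    moreover have f_nonneg: "coeff (f k) i \<ge> 0" if k: "k \<in> {1..n}" for k i
    proof (cases "k = n")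
      case True
      then show ?thesis using u_nonneg[of n i] n by (simp add: f_def)
    next
      case False
      then show ?thesis using p[of "n - k"] u_nonneg[of k] k
        by (auto simp: f_def P_def intro!: coeff_mult_nonneg)
    qed
    moreover have "coeff q i \<ge> 0" for i
      unfolding q_def by (auto simp: coeff_sum intro!: divide_nonneg_nonneg sum_nonneg f_nonneg)
    moreover have "coeff q i > 0" if "i \<le> n * ?m - 1" for i
    proof -
      have "coeff (f n) i > 0" using u[of n] n that by (auto simp: f_def U_def)
      then have "(\<Sum>k=1..n. coeff (f k) i) > 0"
        using n by (intro sum_pos2[of _ n]) (auto intro: f_nonneg)
      then show ?thesis using n by (simp add: q_def coeff_sum)
    qed
    ultimately show ?thesis by blast
  qed
qed

theorem mainTheorem5:
  fixes a b n :: nat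
  assumes "a > 0" and "b > 0" and "n > 0"
  shows "ehrhart_positive (n * (a + b)) (catalan_bases a b n)"
proof -
  obtain p where p: "\<forall>t>0. poly p (real t) = real (card (excursions (excess (t * b)) (blocks (a + b) t) n))"
    and deg: "degree p \<le> n * (a + b) - 1" and pos: "\<forall>i\<le>n * (a + b) - 1. coeff p i > 0"
    using exists_excursion_poly[OF assms(1,2), of n] assms(3) by blast
  have "catalan_set a b n \<subseteq> {1..n * (a + b)}" by (auto simp: catalan_set_def)
  then have "is_ehrhart_polynomial (n * (a + b)) (catalan_bases a b n) p"
    using p by (simp add: is_ehrhart_polynomial_def catalan_bases_def
        card_scaled_schubert_polytope card_excursions_blocks[OF assms(2)])
  then have "ehrhart_polynomial (n * (a + b)) (catalan_bases a b n) = p"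
    by (rule ehrhart_polynomial_eqI)
  then show ?thesis using deg pos by (simp add: ehrhart_positive_def)
qed

end
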